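(* Let $G=\mathrm{Aut}(\mathbb{Q}_0)$ be the group of all circular order preserving permutations of the rational circle $\mathbb{Q}_0=\mathbb{Q}/\mathbb{Z}$, with the pointwise topology $\tau_0$ coming from the discrete topology on $\mathbb{Q}_0$. Let $a_0\in\mathbb{Q}_0$ and let $H:=G_{a_0}=\{g\in G: g(a_0)=a_0\}$ (which is topologically isomorphic to $\mathrm{Aut}(\mathbb{Q},\leq)$). Then $H$ is an inj-key subgroup of $(G,\tau_0)$, but $H$ is not a co-minimal subgroup of $(G,\tau_0)$.
   Context: $\mathbb{Q}_0=\mathbb{Q}/\mathbb{Z}\subset\mathbb{T}=\mathbb{R}/\mathbb{Z}$ carries the usual counter-clockwise circular order: $[a,b,c]$ means that $a,b,c$ are distinct and are met in this order when going counter-clockwise. A permutation $g$ preserves the circular order if $[a,b,c]$ implies $[g(a),g(b),g(c)]$. The topology $\tau_0$ on $G$ is inherited from the product $(\mathbb{Q}_0,\text{discrete})^{\mathbb{Q}_0}$. $\mathrm{Aut}(\mathbb{Q},\leq)$ is the group of order preserving permutations of $\mathbb{Q}$ with the pointwise topology coming from discrete $\mathbb{Q}$. For a Hausdorff topological group $(G,\gamma)$, $\mathcal{T}_{\downarrow}(G,\gamma)$ denotes the set of all Hausdorff group topologies $\sigma\subseteq\gamma$ on $G$. For a subgroup $H$ of $G$, $\sigma|_H$ is the subspace topology on $H$ and $\sigma/H$ is the quotient topology on the coset space $G/H=\{gH:g\in G\}$. $H$ is inj-key in $(G,\gamma)$ if for all $\sigma_1,\sigma_2\in\mathcal{T}_{\downarrow}(G,\gamma)$,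 $\sigma_1|_H=\sigma_2|_H$ implies $\sigma_1=\sigma_2$. $H$ is co-minimal in $(G,\gamma)$ if $\sigma/H=\gamma/H$ for every $\sigma\in\mathcal{T}_{\downarrow}(G,\gamma)$. *)

theory Defs
  imports "HOL-Analysis.Analysis" "HOL-Algebra.Bij" "HOL-Algebra.Left_Coset"
begin

section \<open>Topological groups\<close>

definition topological_group :: "('a, 'b) monoid_scheme \<Rightarrow> 'a topology \<Rightarrow> bool" where
  "topological_group G \<tau> \<longleftrightarrow>
     group G \<and> topspace \<tau> = carrier G \<and>
     continuous_map (prod_topology \<tau> \<tau>) \<tau> (\<lambda>(x, y). x \<otimes>\<^bsub>G\<^esub> y) \<and>
     continuous_map \<tau> \<tau> (\<lambda>x. inv\<^bsub>G\<^esub> x)"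

definition hausdorff_topological_group :: "('a, 'b) monoid_scheme \<Rightarrow> 'a topology \<Rightarrow> bool" where
  "hausdorff_topological_group G \<tau> \<longleftrightarrow> topological_group G \<tau> \<and> Hausdorff_space \<tau>"

definition coarser_hausdorff_topologies ::
  "('a, 'b) monoid_scheme \<Rightarrow> 'a topology \<Rightarrow> 'a topology set" where
  "coarser_hausdorff_topologies G \<gamma> =
     {\<sigma>. hausdorff_topological_group G \<sigma> \<and> (\<forall>U. openin \<sigma> U \<longrightarrow> openin \<gamma> U)}"

definition coset_topology ::
  "('a, 'b) monoid_scheme \<Rightarrow> 'a topology \<Rightarrow> 'a set \<Rightarrow> 'a set topology" where
  "coset_topology G \<sigma> H =
     topology (\<lambda>V. V \<subseteq> lcosets\<^bsub>G\<^esub> H \<and> openin \<sigma> {g \<in> carrier G. g <#\<^bsub>G\<^esub> H \<in> V})"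

lemma openin_coset_topology:
  assumes "topspace \<sigma> = carrier G"
  shows "openin (coset_topology G \<sigma> H) V \<longleftrightarrow>
    V \<subseteq> lcosets\<^bsub>G\<^esub> H \<and> openin \<sigma> {g \<in> carrier G. g <#\<^bsub>G\<^esub> H \<in> V}"
proof -
  let ?P = "\<lambda>V. V \<subseteq> lcosets\<^bsub>G\<^esub> H \<and> openin \<sigma> {g \<in> carrier G. g <#\<^bsub>G\<^esub> H \<in> V}"
  have "istopology ?P"
    unfolding istopology_def
  proof (intro conjI allI impI)
    fix S T assume S: "?P S" and T: "?P T"
    show "S \<inter> T \<subseteq> lcosets\<^bsub>G\<^esub> H" using S by blast
    have "{g \<in> carrier G. g <#\<^bsub>G\<^esub> H \<in> S \<inter> T} =
        {g \<in> carrier G. g <#\<^bsub>G\<^esub> H \<in> S} \<inter> {g \<in> carrier G. g <#\<^bsub>G\<^esub> H \<in> T}" by blast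
    then show "openin \<sigma> {g \<in> carrier G. g <#\<^bsub>G\<^esub> H \<in> S \<inter> T}" using S T
      by (simp only: openin_Int)
  next
    fix K assume K: "\<forall>S\<in>K. ?P S"
    then show "\<Union>K \<subseteq> lcosets\<^bsub>G\<^esub> H" by blast
    have "{g \<in> carrier G. g <#\<^bsub>G\<^esub> H \<in> \<Union>K} =
        (\<Union>S\<in>K. {g \<in> carrier G. g <#\<^bsub>G\<^esub> H \<in> S})" by blast
    then show "openin \<sigma> {g \<in> carrier G. g <#\<^bsub>G\<^esub> H \<in> \<Union>K}" using K by auto
  qed
  then show ?thesis
    unfolding coset_topology_def by (simp add: topology_inverse')
qed

text \<open>The next two notions are meant for a Hausdorff topological group \<open>(G, \<gamma>)\<close> and a
  subgroup \<open>H\<close>.  These standing assumptions are not built into them; for the circle they are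
  \<open>hausdorff_topological_group_Aut_circle\<close> and \<open>subgroup_stabilizer_circle\<close> below.\<close>

definition inj_key :: "('a, 'b) monoid_scheme \<Rightarrow> 'a topology \<Rightarrow> 'a set \<Rightarrow> bool" where
  "inj_key G \<gamma> H \<longleftrightarrow>
     (\<forall>\<sigma>\<^sub>1 \<in> coarser_hausdorff_topologies G \<gamma>. \<forall>\<sigma>\<^sub>2 \<in> coarser_hausdorff_topologies G \<gamma>.
        subtopology \<sigma>\<^sub>1 H = subtopology \<sigma>\<^sub>2 H \<longrightarrow> \<sigma>\<^sub>1 = \<sigma>\<^sub>2)"

definition co_minimal :: "('a, 'b) monoid_scheme \<Rightarrow> 'a topology \<Rightarrow> 'a set \<Rightarrow> bool" where
  "co_minimal G \<gamma> H \<longleftrightarrow>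
     (\<forall>\<sigma> \<in> coarser_hausdorff_topologies G \<gamma>. coset_topology G \<sigma> H = coset_topology G \<gamma> H)"

definition topologically_isomorphic ::
  "('a, 'c) monoid_scheme \<Rightarrow> 'a topology \<Rightarrow> ('b, 'd) monoid_scheme \<Rightarrow> 'b topology \<Rightarrow> bool" where
  "topologically_isomorphic G \<sigma> K \<tau> \<longleftrightarrow> (\<exists>\<phi> \<in> iso G K. homeomorphic_map \<sigma> \<tau> \<phi>)"


section \<open>Permutation groups and the pointwise topology\<close>

definition permutation_group :: "('a \<Rightarrow> 'a) set \<Rightarrow> ('a \<Rightarrow> 'a) monoid" where
  "permutation_group A = BijGroup UNIV \<lparr>carrier := A\<rparr>"

definition pointwise_topology :: "('a \<Rightarrow> 'a) set \<Rightarrow> ('a \<Rightarrow> 'a) topology" where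
  "pointwise_topology A = subtopology (product_topology (\<lambda>_. discrete_topology UNIV) UNIV) A"

lemma Bij_UNIV: "Bij UNIV = {f. bij f}"
  by (auto simp: Bij_def)

lemma permutation_group_simps:
  assumes "A \<subseteq> {f. bij f}"
  shows "carrier (permutation_group A) = A"
    and "\<one>\<^bsub>permutation_group A\<^esub> = id"
    and "f \<in> A \<Longrightarrow> g \<in> A \<Longrightarrow> f \<otimes>\<^bsub>permutation_group A\<^esub> g = f \<circ> g"
  using assms by (auto simp: permutation_group_def BijGroup_def Bij_UNIV compose_def)

lemma group_permutation_group:
  assumes "A \<subseteq> {f. bij f}" "id \<in> A" "\<And>f g. f \<in> A \<Longrightarrow> g \<in> A \<Longrightarrow> f \<circ> g \<in> A"
    "\<And>f. f \<in> A \<Longrightarrow> inv_into UNIV f \<in> A"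
  shows "group (permutation_group A)"
proof (rule groupI)
  fix x assume "x \<in> carrier (permutation_group A)"
  then have x: "x \<in> A" by (simp add: permutation_group_simps assms(1))
  then have "inv_into UNIV x \<circ> x = id" using assms(1) by (auto simp: bij_def)
  then show "\<exists>y\<in>carrier (permutation_group A).
      y \<otimes>\<^bsub>permutation_group A\<^esub> x = \<one>\<^bsub>permutation_group A\<^esub>"
    using x assms(4) by (auto simp: permutation_group_simps assms(1))
qed (use assms in \<open>auto simp: permutation_group_simps comp_assoc\<close>)

lemma hausdorff_topological_group_pointwise:
  assumes A: "A \<subseteq> {f. bij f}" and "id \<in> A" "\<And>f g. f \<in> A \<Longrightarrow> g \<in> A \<Longrightarrow> f \<circ> g \<in> A"
    "\<And>f. f \<in> A \<Longrightarrow> inv_into UNIV f \<in> A"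
  shows "hausdorff_topological_group (permutation_group A) (pointwise_topology A)"
proof -
  note ps = permutation_group_simps[OF A]
  interpret group "permutation_group A" by (rule group_permutation_group) (use assms in auto)
  let ?T = "pointwise_topology A"
  let ?D = "discrete_topology UNIV :: 'a topology"
  have top: "topspace ?T = A" by (simp add: pointwise_topology_def)
  have op: "openin ?T {f \<in> A. f x = y}" for x y
  proof -
    have "continuous_map ?T ?D (\<lambda>f. f x)"
      unfolding pointwise_topology_def
      by (intro continuous_map_from_subtopology continuous_map_product_coordinates) auto
    from openin_continuous_map_preimage[OF this, of "{y}"] show ?thesis
      by (simp add: top)
  qed
  have cont: "continuous_map X ?T F"
    if F: "\<And>p. p \<in> topspace X \<Longrightarrow> F p \<in> A"
      and loc: "\<And>p x. p \<in> topspace X \<Longrightarrow> \<exists>U. openin X U \<and> p \<in> U \<and> (\<forall>q\<in>U. F q x = F p x)"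
    for X :: "'c topology" and F
  proof -
    have "continuous_map X ?D (\<lambda>p. F p x)" for x
      unfolding continuous_map_def
    proof (intro conjI allI impI)
      fix V :: "'a set"
      show "openin X {p \<in> topspace X. F p x \<in> V}"
      proof (subst openin_subopen, safe)
        fix p assume p: "p \<in> topspace X" "F p x \<in> V"
        then obtain U where U: "openin X U" "p \<in> U" "\<And>q. q \<in> U \<Longrightarrow> F q x = F p x"
          using loc by meson
        have "U \<subseteq> {p \<in> topspace X. F p x \<in> V}"
        proof
          fix q assume q: "q \<in> U"
          then have "q \<in> topspace X" using openin_subset[OF U(1)] by blast
          then show "q \<in> {p \<in> topspace X. F p x \<in> V}"
            using p(2) U(3)[OF q] by simp
        qed
        then show "\<exists>T. openin X T \<and> p \<in> T \<and> T \<subseteq> {p \<in> topspace X. F p x \<in> V}"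
          using U(1,2) by blast
      qed
    qed auto
    then show ?thesis
      unfolding pointwise_topology_def
      by (auto simp: continuous_map_in_subtopology continuous_map_componentwise_UNIV F)
  qed
  have inv: "inv\<^bsub>permutation_group A\<^esub> f = inv_into UNIV f" if "f \<in> A" for f
  proof (rule inv_equality)
    show "inv_into UNIV f \<otimes>\<^bsub>permutation_group A\<^esub> f = \<one>\<^bsub>permutation_group A\<^esub>"
      using that assms by (auto simp: ps bij_def subset_iff)
  qed (use that assms in \<open>auto simp: ps\<close>)
  have "continuous_map (prod_topology ?T ?T) ?T (\<lambda>(x, y). x \<otimes>\<^bsub>permutation_group A\<^esub> y)"
  proof (rule cont)
    fix p x assume "p \<in> topspace (prod_topology ?T ?T)"
    then obtain f g where p: "p = (f, g)" "f \<in> A" "g \<in> A" by (auto simp: top)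
    let ?U = "{f' \<in> A. f' (g x) = f (g x)} \<times> {g' \<in> A. g' x = g x}"
    have "openin (prod_topology ?T ?T) ?U" by (simp add: openin_prod_Times_iff op)
    then show "\<exists>U. openin (prod_topology ?T ?T) U \<and> p \<in> U \<and>
        (\<forall>q\<in>U. (case q of (x, y) \<Rightarrow> x \<otimes>\<^bsub>permutation_group A\<^esub> y) x =
                (case p of (x, y) \<Rightarrow> x \<otimes>\<^bsub>permutation_group A\<^esub> y) x)"
      using p by (intro exI[of _ ?U]) (auto simp: ps)
  qed (use assms in \<open>auto simp: top ps\<close>)
  moreover have "continuous_map ?T ?T (\<lambda>x. inv\<^bsub>permutation_group A\<^esub> x)"
  proof (rule cont)
    fix f x assume "f \<in> topspace ?T"
    then have f: "f \<in> A" by (simp add: top)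
    then obtain y where y: "f y = x" using A by (metis (no_types) bij_def surj_def mem_Collect_eq subsetD)
    have "(inv\<^bsub>permutation_group A\<^esub> h) x = y" if "h \<in> A" "h y = x" for h
    proof -
      have "inj h" using that(1) A by (auto simp: bij_def)
      then show ?thesis using inv[OF that(1)] inv_f_eq[of h y x] that(2) by simp
    qed
    note eq = this
    have "\<forall>h\<in>{h \<in> A. h y = x}.
        (inv\<^bsub>permutation_group A\<^esub> h) x = (inv\<^bsub>permutation_group A\<^esub> f) x"
      unfolding eq[OF f y] using eq by blast
    moreover have "f \<in> {h \<in> A. h y = x}"
      using f y by blast
    ultimately show "\<exists>U. openin ?T U \<and> f \<in> U \<and>
        (\<forall>q\<in>U. (inv\<^bsub>permutation_group A\<^esub> q) x = (inv\<^bsub>permutation_group A\<^esub> f) x)"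
      using op[of y x] by (intro exI[of _ "{h \<in> A. h y = x}"] conjI) assumption+
  qed (use assms in \<open>auto simp: top ps inv\<close>)
  moreover have "Hausdorff_space ?T"
    unfolding pointwise_topology_def
    by (intro Hausdorff_space_subtopology) (simp add: Hausdorff_space_product_topology)
  ultimately show ?thesis
    unfolding hausdorff_topological_group_def topological_group_def
    using is_group by (simp add: top ps)
qed


section \<open>The rational circle\<close>

quotient_type rat_circle = rat / "\<lambda>x y :: rat. x - y \<in> \<int>"
proof (rule equivpI)
  show "reflp (\<lambda>x y :: rat. x - y \<in> \<int>)" by (simp add: reflp_def)
  show "symp (\<lambda>x y :: rat. x - y \<in> \<int>)"
    unfolding symp_def by (metis Ints_minus minus_diff_eq)
  show "transp (\<lambda>x y :: rat. x - y \<in> \<int>)"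
    unfolding transp_def by (metis Ints_add diff_add_cancel add_diff_eq)
qed

text \<open>\<open>abs_rat_circle\<close> is the projection onto the rationals modulo the integers.  Going
  counter-clockwise once around from \<open>a\<close> amounts to running from a representative \<open>x\<close> of \<open>a\<close>
  up to \<open>x + 1\<close>.\<close>

definition circ_ord :: "rat_circle \<Rightarrow> rat_circle \<Rightarrow> rat_circle \<Rightarrow> bool" where
  "circ_ord a b c \<longleftrightarrow>
     (\<exists>x y z. a = abs_rat_circle x \<and> b = abs_rat_circle y \<and> c = abs_rat_circle z \<and>
              x < y \<and> y < z \<and> z < x + 1)"

definition Aut_circle :: "(rat_circle \<Rightarrow> rat_circle) set" where
  "Aut_circle = {g. bij g \<and> (\<forall>a b c. circ_ord a b c \<longrightarrow> circ_ord (g a) (g b) (g c))}"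

definition Aut_rat :: "(rat \<Rightarrow> rat) set" where
  "Aut_rat = {g. bij g \<and> mono g}"

definition stabilizer_circle :: "rat_circle \<Rightarrow> (rat_circle \<Rightarrow> rat_circle) set" where
  "stabilizer_circle a = {g \<in> Aut_circle. g a = a}"

lemma circ_ord_iff:
  assumes "0 \<le> x" "x < 1" "0 \<le> y" "y < 1" "0 \<le> z" "z < 1"
  shows "circ_ord (abs_rat_circle x) (abs_rat_circle y) (abs_rat_circle z) \<longleftrightarrow>
    x < y \<and> y < z \<or> y < z \<and> z < x \<or> z < x \<and> x < y"
    (is "?L \<longleftrightarrow> ?R")
proof
  assume ?L
  then obtain x' y' z' where *: "x - x' \<in> \<int>" "y - y' \<in> \<int>" "z - z' \<in> \<int>"
    and less: "x' < y'" "y' < z'" "z' < x' + 1"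
    unfolding circ_ord_def rat_circle.abs_eq_iff by blast
  from * obtain i j k where "x - x' = of_int i" "y - y' = of_int j" "z - z' = of_int k"
    by (auto elim!: Ints_cases)
  then have eqs: "x' = x - of_int i" "y' = y - of_int j" "z' = z - of_int k" by auto
  have "(of_int (i - j) :: rat) < of_int 2" "of_int (- 1) < (of_int (i - j) :: rat)"
    "(of_int (i - k) :: rat) < of_int 2" "of_int (- 1) < (of_int (i - k) :: rat)"
    using less assms unfolding eqs by (simp_all del: of_int_less_iff)
  then have "i - j < 2" "- 1 < i - j" "i - k < 2" "- 1 < i - k"
    unfolding of_int_less_iff by blast+
  then have "j = i \<or> j = i - 1" "k = i \<or> k = i - 1" by linarith+
  then show ?R
    using less assms unfolding eqs by auto
next
  have shift: "abs_rat_circle u = abs_rat_circle (u + 1)" for u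
    by (simp add: rat_circle.abs_eq_iff)
  assume ?R
  then consider "x < y" "y < z" | "y < z" "z < x" | "z < x" "x < y" by blast
  then show ?L
  proof cases
    case 1
    then show ?thesis unfolding circ_ord_def using assms by force
  next
    case 2
    then have "x < y + 1" "y + 1 < z + 1" "z + 1 < x + 1" using assms by auto
    then show ?thesis unfolding circ_ord_def using shift by blast
  next
    case 3
    then have "x < y" "y < z + 1" "z + 1 < x + 1" using assms by auto
    then show ?thesis unfolding circ_ord_def using shift by blast
  qed
qed

lemma rat_circle_cases:
  obtains x where "0 \<le> x" "x < 1" "a = abs_rat_circle x"
proof -
  obtain u where u: "a = abs_rat_circle u" by (metis Quotient3_def Quotient3_rat_circle)
  have "abs_rat_circle u = abs_rat_circle (u - of_int \<lfloor>u\<rfloor>)"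
    by (simp add: rat_circle.abs_eq_iff)
  moreover have "0 \<le> u - of_int \<lfloor>u\<rfloor>" "u - of_int \<lfloor>u\<rfloor> < 1" by linarith+
  ultimately show thesis using that u by metis
qed

lemma circ_ord_rotate: "circ_ord a b c \<Longrightarrow> circ_ord b c a"
  by (rule rat_circle_cases[of a], rule rat_circle_cases[of b], rule rat_circle_cases[of c])
    (auto simp: circ_ord_iff)

lemma circ_ord_asym: "circ_ord a b c \<Longrightarrow> \<not> circ_ord a c b"
  by (rule rat_circle_cases[of a], rule rat_circle_cases[of b], rule rat_circle_cases[of c])
    (auto simp: circ_ord_iff)

lemma circ_ord_distinct: "circ_ord a b c \<Longrightarrow> a \<noteq> b \<and> b \<noteq> c \<and> a \<noteq> c"
  using circ_ord_asym circ_ord_rotate by metis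

lemma circ_ord_total: "a \<noteq> b \<Longrightarrow> b \<noteq> c \<Longrightarrow> a \<noteq> c \<Longrightarrow> circ_ord a b c \<or> circ_ord a c b"
proof -
  assume d: "a \<noteq> b" "b \<noteq> c" "a \<noteq> c"
  obtain x where x: "0 \<le> x" "x < 1" "a = abs_rat_circle x" by (rule rat_circle_cases)
  obtain y where y: "0 \<le> y" "y < 1" "b = abs_rat_circle y" by (rule rat_circle_cases)
  obtain z where z: "0 \<le> z" "z < 1" "c = abs_rat_circle z" by (rule rat_circle_cases)
  have "x \<noteq> y" "y \<noteq> z" "x \<noteq> z" using d x y z by auto
  then show ?thesis
    unfolding x(3) y(3) z(3) by (subst (1 2) circ_ord_iff) (use x y z in auto)
qed

lemma Aut_circle_closed:
  "Aut_circle \<subseteq> {f. bij f}" "id \<in> Aut_circle"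
  "f \<in> Aut_circle \<Longrightarrow> g \<in> Aut_circle \<Longrightarrow> f \<circ> g \<in> Aut_circle"
  "f \<in> Aut_circle \<Longrightarrow> inv_into UNIV f \<in> Aut_circle"
proof -
  assume f: "f \<in> Aut_circle"
  then have bij: "bij f" and pres: "\<And>a b c. circ_ord a b c \<Longrightarrow> circ_ord (f a) (f b) (f c)"
    by (auto simp: Aut_circle_def)
  have "circ_ord (inv_into UNIV f a) (inv_into UNIV f b) (inv_into UNIV f c)" if abc: "circ_ord a b c" for a b c
  proof (rule ccontr)
    assume n: "\<not> circ_ord (inv_into UNIV f a) (inv_into UNIV f b) (inv_into UNIV f c)"
    have eq: "f (inv_into UNIV f d) = d" for d using bij by (simp add: bij_is_surj surj_f_inv_f)
    have "inv_into UNIV f a \<noteq> inv_into UNIV f b" "inv_into UNIV f b \<noteq> inv_into UNIV f c" "inv_into UNIV f a \<noteq> inv_into UNIV f c"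
      using circ_ord_distinct[OF abc] eq by metis+
    with n have "circ_ord (inv_into UNIV f a) (inv_into UNIV f c) (inv_into UNIV f b)" using circ_ord_total by blast
    from pres[OF this] have "circ_ord a c b" by (simp add: eq)
    with circ_ord_asym[OF abc] show False by blast
  qed
  then show "inv_into UNIV f \<in> Aut_circle"
    using bij by (simp add: Aut_circle_def bij_imp_bij_inv)
qed (auto simp: Aut_circle_def intro: bij_comp)

lemma hausdorff_topological_group_Aut_circle:
  "hausdorff_topological_group (permutation_group Aut_circle) (pointwise_topology Aut_circle)"
  by (rule hausdorff_topological_group_pointwise) (use Aut_circle_closed in blast)+

lemma subgroup_stabilizer_circle:
  "subgroup (stabilizer_circle a) (permutation_group Aut_circle)"
proof -
  interpret group "permutation_group Aut_circle"
    by (rule group_permutation_group) (use Aut_circle_closed in blast)+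
  note ps = permutation_group_simps[OF Aut_circle_closed(1)]
  show ?thesis
  proof (rule subgroupI)
    show "stabilizer_circle a \<noteq> {}" using Aut_circle_closed(2) by (auto simp: stabilizer_circle_def)
    fix f assume f: "f \<in> stabilizer_circle a"
    then have fA: "f \<in> Aut_circle" and fa: "f a = a" by (auto simp: stabilizer_circle_def)
    have "inv\<^bsub>permutation_group Aut_circle\<^esub> f \<in> Aut_circle"
      using inv_closed[of f] fA by (simp add: ps)
    moreover from this have "inv\<^bsub>permutation_group Aut_circle\<^esub> f \<circ> f = id"
      using l_inv[of f] fA by (simp add: ps)
    ultimately show "inv\<^bsub>permutation_group Aut_circle\<^esub> f \<in> stabilizer_circle a"
      using fa unfolding stabilizer_circle_def by (metis (mono_tags) comp_apply id_apply mem_Collect_eq)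
  qed (use Aut_circle_closed(3) in \<open>auto simp: stabilizer_circle_def ps\<close>)
qed

lemma Aut_rat_closed:
  "Aut_rat \<subseteq> {f. bij f}" "id \<in> Aut_rat"
  "f \<in> Aut_rat \<Longrightarrow> g \<in> Aut_rat \<Longrightarrow> f \<circ> g \<in> Aut_rat"
  "f \<in> Aut_rat \<Longrightarrow> inv_into UNIV f \<in> Aut_rat"
proof -
  assume f: "f \<in> Aut_rat"
  then have bij: "bij f" and mono: "mono f" by (auto simp: Aut_rat_def)
  have "inv_into UNIV f x \<le> inv_into UNIV f y" if "x \<le> y" for x y
    using that mono bij by (metis bij_is_surj monoD nle_le surj_f_inv_f)
  then show "inv_into UNIV f \<in> Aut_rat"
    using bij by (simp add: Aut_rat_def bij_imp_bij_inv mono_def)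
qed (auto simp: Aut_rat_def mono_def intro: bij_comp)

lemma hausdorff_topological_group_Aut_rat:
  "hausdorff_topological_group (permutation_group Aut_rat) (pointwise_topology Aut_rat)"
  by (rule hausdorff_topological_group_pointwise) (use Aut_rat_closed in blast)+

end

theory Submission
  imports Defs
begin

text \<open>Cutting the circle at \<open>a\<^sub>0\<close> identifies its complement with the ordered rationals, which gives
  the isomorphism of \<open>H\<close> with the automorphism group of the rationals.

  The subgroup \<open>H\<close> is not co-minimal because pointwise convergence with respect to the usual topology
  of the rational circle is a coarser Hausdorff group topology in which small rotations tend to the
  identity, so that \<open>H\<close> is not open in it.

  For the inj-key property, let \<open>\<sigma>\<^sub>1\<close> and \<open>\<sigma>\<^sub>2\<close> agree on \<open>H\<close>.  Every Hausdorff group topology makes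
  all orbit maps continuous into the usual circle, since \<open>f\<close> moves a point of an arc into that arc iff
  some conjugate by \<open>f\<close> of a map supported in the arc fails to commute with some map supported in the
  arc.  If \<open>W \<inter> V \<subseteq> H\<close> for neighbourhoods \<open>W\<close> and \<open>V\<close> of the identity in \<open>\<sigma>\<^sub>1\<close> and \<open>\<sigma>\<^sub>2\<close>, then a
  conjugate of this inclusion restricted to \<open>H\<close> shows that some \<open>\<sigma>\<^sub>1\<close>-neighbourhood meets \<open>H\<close> inside
  another stabilizer; this forces a finite orbit under a neighbourhood, hence open stabilizers, and
  \<open>\<sigma>\<^sub>1\<close> is the pointwise topology (likewise \<open>\<sigma>\<^sub>2\<close>).  Otherwise \<open>W \<inter> V\<close> always moves \<open>a\<^sub>0\<close>, by a
  small amount and to both sides; as it also contains the pointwise stabilizer of a finite set,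
  \<open>(W \<inter> V)\<^sup>2 a\<^sub>0\<close> contains an arc around \<open>a\<^sub>0\<close>, and the argument of Merson's lemma (topologies that agree
  on a subgroup and on its coset space are equal) applies.\<close>

section \<open>Coordinates on the rational circle\<close>

definition circ_pos :: "rat_circle \<Rightarrow> rat" where
  "circ_pos a = frac (rep_rat_circle a)"

lemma abs_rat_circle_rep: "abs_rat_circle (rep_rat_circle a) = a"
  using Quotient3_rat_circle by (rule Quotient3_abs_rep)

lemma circ_pos_bounds: "0 \<le> circ_pos a" "circ_pos a < 1"
  by (auto simp: circ_pos_def frac_ge_0 frac_lt_1)

lemma abs_rat_circle_circ_pos: "abs_rat_circle (circ_pos a) = a"
proof -
  have "abs_rat_circle (circ_pos a) = abs_rat_circle (rep_rat_circle a)"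
    by (simp add: circ_pos_def frac_def rat_circle.abs_eq_iff)
  then show ?thesis by (simp add: abs_rat_circle_rep)
qed

text \<open>Reduces circular order to linear inequalities between coordinates in [0,1), so that the
  combinatorial facts about few points become arithmetic.\<close>

lemma circ_ord_pos:
  "circ_ord a b c \<longleftrightarrow>
     circ_pos a < circ_pos b \<and> circ_pos b < circ_pos c \<or>
     circ_pos b < circ_pos c \<and> circ_pos c < circ_pos a \<or>
     circ_pos c < circ_pos a \<and> circ_pos a < circ_pos b"
  using circ_ord_iff[of "circ_pos a" "circ_pos b" "circ_pos c"]
  by (simp add: abs_rat_circle_circ_pos circ_pos_bounds)

lemma circ_ord_trans: "circ_ord a b c \<Longrightarrow> circ_ord a c d \<Longrightarrow> circ_ord a b d"
  unfolding circ_ord_pos by auto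

lemma circ_ord_rotate_back: "circ_ord a b c \<Longrightarrow> circ_ord c a b"
  by (rule circ_ord_rotate[OF circ_ord_rotate])

lemma circ_ord_trans_right: "circ_ord a b c \<Longrightarrow> circ_ord b d c \<Longrightarrow> circ_ord a d c"
  by (rule circ_ord_rotate[OF circ_ord_trans[OF circ_ord_rotate_back circ_ord_rotate_back]])

lemma circ_ord_trans_left: "circ_ord a b c \<Longrightarrow> circ_ord b d c \<Longrightarrow> circ_ord a b d"
  by (rule circ_ord_rotate_back[OF circ_ord_trans[OF _ circ_ord_rotate]])

text \<open>Nesting of arcs around \<open>y\<close>: moving both ends of the arc from
  \<open>a\<close> to \<open>b\<close> towards \<open>y\<close> gives a smaller arc. It controls
  images of arcs under automorphisms.\<close>

lemma circ_ord_arc_subset: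
  assumes y: "circ_ord a y b" and c: "circ_ord a c y" and d: "circ_ord y d b"
    and z: "circ_ord c z d"
  shows "circ_ord a z b"
proof -
  have "circ_ord a c d" using c circ_ord_trans_left[OF y d] by (rule circ_ord_trans)
  then have "circ_ord a z d" using z by (rule circ_ord_trans_right)
  then show ?thesis using circ_ord_trans_right[OF y d] by (rule circ_ord_trans)
qed

lemma circ_ord_chain: "circ_ord p a b \<Longrightarrow> circ_ord p b c \<Longrightarrow> circ_ord a b c"
  by (rule circ_ord_trans_left[OF circ_ord_rotate circ_ord_rotate])

text \<open>Away from \<open>p\<close> the circular order is the cyclic closure of the linear order
  obtained by cutting the circle at \<open>p\<close>. Hence a map fixing \<open>p\<close> can be
  tested on that linear order alone.\<close>

lemma circ_ord_cut:
  assumes "a \<noteq> p" "b \<noteq> p" "c \<noteq> p"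
  shows "circ_ord a b c \<longleftrightarrow>
     circ_ord p a b \<and> circ_ord p b c \<or> circ_ord p b c \<and> circ_ord p c a \<or>
     circ_ord p c a \<and> circ_ord p a b"
  (is "_ \<longleftrightarrow> ?R")
proof
  assume abc: "circ_ord a b c"
  then have "\<not> circ_ord a c b" "\<not> circ_ord b a c" "\<not> circ_ord c b a"
    by (rule circ_ord_asym, rule circ_ord_asym[OF circ_ord_rotate],
        rule circ_ord_asym[OF circ_ord_rotate_back])
  moreover have "circ_ord p x y \<or> circ_ord p y x" if "x \<noteq> p" "y \<noteq> p" "x \<noteq> y" for x y
    using that circ_ord_total[of p x y] by auto
  ultimately show ?R
    using assms circ_ord_distinct[OF abc] circ_ord_chain by meson
next
  assume ?R
  then show "circ_ord a b c"
    using circ_ord_chain[of p a b c] circ_ord_chain[of p b c a] circ_ord_chain[of p c a b]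
      circ_ord_rotate[of b c a] circ_ord_rotate_back[of c a b] circ_ord_rotate_back[of b c a]
      circ_ord_rotate[of c a b]
    by blast
qed

section \<open>Circular automorphisms\<close>

text \<open>Reflection of the order follows from totality: three distinct points not in the order
  \<open>a\<close>, \<open>b\<close>, \<open>c\<close> are in the opposite order, which
  \<open>f\<close> also preserves.\<close>

lemma Aut_circleD:
  assumes "f \<in> Aut_circle"
  shows "bij f" and "circ_ord (f a) (f b) (f c) \<longleftrightarrow> circ_ord a b c"
proof -
  show bij: "bij f" using assms by (simp add: Aut_circle_def)
  have pres: "\<And>a b c. circ_ord a b c \<Longrightarrow> circ_ord (f a) (f b) (f c)"
    using assms by (auto simp: Aut_circle_def)
  show "circ_ord (f a) (f b) (f c) \<longleftrightarrow> circ_ord a b c"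
    using pres circ_ord_total circ_ord_asym circ_ord_distinct by metis
qed

lemma Aut_circle_inv:
  assumes "f \<in> Aut_circle"
  shows "f (inv_into UNIV f x) = x" "inv_into UNIV f (f x) = x"
  using Aut_circleD(1)[OF assms] by (auto simp: bij_is_surj surj_f_inv_f bij_is_inj)

lemma Aut_circle_inj: "f \<in> Aut_circle \<Longrightarrow> f x = f y \<longleftrightarrow> x = y"
  by (metis Aut_circle_inv(2))

lemma Aut_circle_if_fixes:
  assumes bij: "bij g" and p: "g p = p"
    and ord: "\<And>x y. circ_ord p x y \<Longrightarrow> circ_ord p (g x) (g y)"
  shows "g \<in> Aut_circle"
proof -
  have neq: "g x \<noteq> p \<longleftrightarrow> x \<noteq> p" for x
    using bij p by (metis bij_is_inj inv_f_f)
  have "circ_ord (g a) (g b) (g c)" if abc: "circ_ord a b c" for a b c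
  proof (cases "a = p \<or> b = p \<or> c = p")
    case True
    then show ?thesis using abc ord p circ_ord_rotate by metis
  next
    case False
    then show ?thesis
      using abc ord circ_ord_cut[of a p b c] circ_ord_cut[of "g a" p "g b" "g c"]
      by (auto simp: neq)
  qed
  then show ?thesis using bij by (simp add: Aut_circle_def)
qed

section \<open>Rotations and transitivity\<close>

definition circ_rot :: "rat \<Rightarrow> rat_circle \<Rightarrow> rat_circle" where
  "circ_rot t a = abs_rat_circle (rep_rat_circle a + t)"

text \<open>Independence of the chosen representative: two representatives of a point differ by an
  integer, and so do their translates by \<open>t\<close>.\<close>

lemma circ_rot_abs: "circ_rot t (abs_rat_circle x) = abs_rat_circle (x + t)"
proof -
  have "rep_rat_circle (abs_rat_circle x) - x \<in> \<int>"
    by (metis abs_rat_circle_rep rat_circle.abs_eq_iff)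
  then show ?thesis by (simp add: circ_rot_def rat_circle.abs_eq_iff)
qed

lemma circ_rot_add: "circ_rot s (circ_rot t a) = circ_rot (s + t) a"
  by (metis abs_rat_circle_rep add.assoc add.commute circ_rot_abs)

lemma circ_rot_0: "circ_rot 0 a = a"
  by (metis abs_rat_circle_rep add_0_right circ_rot_abs)

lemma circ_rot_Aut: "circ_rot t \<in> Aut_circle"
proof -
  have "bij (circ_rot t)"
    by (rule o_bij[of "circ_rot (-t)"]) (auto simp: fun_eq_iff circ_rot_add circ_rot_0)
  moreover have "circ_ord (circ_rot t a) (circ_rot t b) (circ_rot t c)" if "circ_ord a b c" for a b c
  proof -
    obtain x y z :: rat where "a = abs_rat_circle x" "b = abs_rat_circle y" "c = abs_rat_circle z"
      "x < y" "y < z" "z < x + 1"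
      using \<open>circ_ord a b c\<close> unfolding circ_ord_def by blast
    then show ?thesis unfolding circ_ord_def
      by (intro exI[of _ "x + t"] exI[of _ "y + t"] exI[of _ "z + t"]) (simp add: circ_rot_abs)
  qed
  ultimately show ?thesis by (simp add: Aut_circle_def)
qed

lemma Aut_circle_transitive:
  obtains g where "g \<in> Aut_circle" "g a = b"
proof -
  let ?t = "rep_rat_circle b - rep_rat_circle a"
  have "circ_rot ?t (abs_rat_circle (rep_rat_circle a)) = b"
    unfolding circ_rot_abs by (simp add: abs_rat_circle_rep)
  then have "circ_rot ?t a = b" by (simp add: abs_rat_circle_rep)
  then show thesis using that circ_rot_Aut by blast
qed

section \<open>The circle cut at a point as a copy of the ordered rationals\<close>

definition squash :: "rat \<Rightarrow> rat" where
  "squash t = (if 0 \<le> t then 1 - 1 / (2 * (1 + t)) else 1 / (2 * (1 - t)))"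

lemma squash_bounds: "0 < squash t" "squash t < 1"
  by (auto simp: squash_def divide_simps)

text \<open>The two branches of \<open>squash\<close> are rational functions, so rationals go to
  rationals, and they meet at the value 1/2, which separates them in the mixed case.\<close>

lemma squash_strict_mono:
  assumes "s < t"
  shows "squash s < squash t"
proof -
  consider "0 \<le> s" | "s < 0" "0 \<le> t" | "t < 0" using assms by linarith
  then show ?thesis
  proof cases
    case 2
    then have "squash s < 1 / 2" "1 / 2 \<le> squash t"
      by (auto simp: squash_def divide_simps)
    then show ?thesis by linarith
  qed (use assms in \<open>auto simp: squash_def divide_simps algebra_simps\<close>)
qed

lemma squash_surj:
  assumes "0 < u" "u < 1"
  obtains t where "u = squash t"
proof (cases "1 / 2 \<le> u")
  case True
  then have "u = squash (1 / (2 * (1 - u)) - 1)"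
    using assms by (auto simp: squash_def divide_simps)
  then show ?thesis using that by blast
next
  case False
  then have "u = squash (1 - 1 / (2 * u))"
    using assms by (auto simp: squash_def divide_simps)
  then show ?thesis using that by blast
qed

text \<open>Since \<open>squash\<close> is an order isomorphism of the rationals onto the rational
  points of (0,1), this runs counter-clockwise once around the circle from \<open>p\<close>,
  omitting only \<open>p\<close>.\<close>

definition chart :: "rat_circle \<Rightarrow> rat \<Rightarrow> rat_circle" where
  "chart p t = abs_rat_circle (rep_rat_circle p + squash t)"

lemma chart_less:
  assumes "s < t"
  shows "circ_ord p (chart p s) (chart p t)"
  unfolding circ_ord_def chart_def
  by (rule exI[of _ "rep_rat_circle p"], rule exI, rule exI, intro conjI)
    (auto simp: abs_rat_circle_rep squash_bounds squash_strict_mono[OF assms])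

lemma circ_ord_chart: "circ_ord p (chart p s) (chart p t) \<longleftrightarrow> s < t"
  by (metis chart_less circ_ord_asym circ_ord_distinct linorder_neqE)

lemma chart_neq: "chart p t \<noteq> p"
  using chart_less[of t "t + 1" p] circ_ord_distinct by fastforce

lemma chart_eq_iff: "chart p s = chart p t \<longleftrightarrow> s = t"
  by (metis circ_ord_chart circ_ord_distinct linorder_neqE)

lemma chart_surj:
  assumes "a \<noteq> p"
  obtains t where "a = chart p t"
proof -
  define u where "u = frac (rep_rat_circle a - rep_rat_circle p)"
  have a: "a = abs_rat_circle (rep_rat_circle p + u)"
  proof -
    have "abs_rat_circle (rep_rat_circle p + u) = abs_rat_circle (rep_rat_circle a)"
      by (simp add: u_def frac_def rat_circle.abs_eq_iff)
    then show ?thesis by (simp add: abs_rat_circle_rep)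
  qed
  have "u \<noteq> 0" using a assms by (auto simp: abs_rat_circle_rep)
  then have "0 < u" "u < 1"
    using frac_ge_0[of "rep_rat_circle a - rep_rat_circle p"]
      frac_lt_1[of "rep_rat_circle a - rep_rat_circle p"]
    unfolding u_def[symmetric] by auto
  then obtain t where "u = squash t" by (rule squash_surj)
  then show thesis using a that by (simp add: chart_def)
qed

definition unchart :: "rat_circle \<Rightarrow> rat_circle \<Rightarrow> rat" where
  "unchart p a = inv_into UNIV (chart p) a"

lemma unchart_chart [simp]: "unchart p (chart p t) = t"
  by (simp add: unchart_def inj_def chart_eq_iff)

lemma chart_unchart: "a \<noteq> p \<Longrightarrow> chart p (unchart p a) = a"
  by (metis chart_surj unchart_chart)

definition extend :: "rat_circle \<Rightarrow> (rat \<Rightarrow> rat) \<Rightarrow> rat_circle \<Rightarrow> rat_circle" where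
  "extend p k a = (if a = p then p else chart p (k (unchart p a)))"

lemma extend_chart [simp]: "extend p k (chart p t) = chart p (k t)"
  by (simp add: extend_def chart_neq)

lemma extend_base [simp]: "extend p k p = p"
  by (simp add: extend_def)

lemma Aut_rat_strict_mono: "k \<in> Aut_rat \<Longrightarrow> k s < k t \<longleftrightarrow> s < t"
  by (metis (mono_tags, lifting) Aut_rat_def bij_is_inj injD linorder_not_less mem_Collect_eq monoD
      order_le_less)

lemma extend_Aut_circle:
  assumes k: "k \<in> Aut_rat"
  shows "extend p k \<in> Aut_circle"
proof (rule Aut_circle_if_fixes)
  have bij: "bij k" using k by (simp add: Aut_rat_def)
  show "bij (extend p k)"
  proof (rule o_bij[of "extend p (inv_into UNIV k)"])
    show "extend p (inv_into UNIV k) \<circ> extend p k = id" "extend p k \<circ> extend p (inv_into UNIV k) = id"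
      using bij by (auto simp: fun_eq_iff extend_def chart_neq chart_unchart bij_is_inj
          bij_is_surj surj_f_inv_f)
  qed
next
  fix x y assume xy: "circ_ord p x y"
  then have "x \<noteq> p" "y \<noteq> p" using circ_ord_distinct by blast+
  then obtain s t where "x = chart p s" "y = chart p t" by (metis chart_surj)
  then show "circ_ord p (extend p k x) (extend p k y)"
    using xy k by (simp add: circ_ord_chart Aut_rat_strict_mono)
qed simp

section \<open>Homogeneity of arcs and automorphisms supported in them\<close>

lemma ray_homogeneous_rat:
  fixes x y s :: rat
  assumes "x < s" "y < s"
  obtains k where "k \<in> Aut_rat" "k x = y" "\<And>t. s \<le> t \<Longrightarrow> k t = t"
proof
  \<comment> \<open>\<open>h c\<close> scales the ray below \<open>s\<close> about its end point
    \<open>s\<close> and is the identity from \<open>s\<close> on; the factor \<open>c\<close> is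
    the one taking \<open>x\<close> to \<open>y\<close>, and \<open>h (1/c)\<close> is the
    inverse.\<close>
  define h :: "rat \<Rightarrow> rat \<Rightarrow> rat" where "h c t = (if t < s then s + (t - s) * c else t)" for c t
  define c where "c = (s - y) / (s - x)"
  have c: "0 < c" "0 < 1 / c" using assms by (simp_all add: c_def)
  have inv: "h a (h b t) = t" if "0 < b" "a * b = 1" for a b t
    using that by (auto simp: h_def mult.assoc mult.commute[of b] mult_less_0_iff)
  have "bij (h c)"
    by (rule o_bij[of "h (1/c)"]) (use c in \<open>auto simp: fun_eq_iff inv\<close>)
  moreover have "h c t \<le> h c u" if tu: "t \<le> u" for t u
  proof (cases "u < s")
    case True
    then show ?thesis using tu c by (auto simp: h_def mult_right_mono)
  next
    case False
    have "h c t \<le> s \<or> h c t = t" using c by (simp add: h_def mult_le_0_iff)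
    moreover have "h c u = u" using False by (simp add: h_def)
    ultimately show ?thesis using tu False by linarith
  qed
  ultimately show "h c \<in> Aut_rat" by (simp add: Aut_rat_def mono_def)
  show "h c x = y" using assms by (simp add: h_def c_def field_simps)
  show "h c t = t" if "s \<le> t" for t using that by (simp add: h_def)
qed

text \<open>In the chart at \<open>p\<close> the arc from \<open>p\<close> to \<open>q\<close> is a
  ray unbounded below, so the scaling on rays transfers to the circle.\<close>

lemma arc_homogeneous:
  assumes x: "circ_ord p x q" and y: "circ_ord p y q"
  obtains g where "g \<in> Aut_circle" "g x = y" "\<And>z. \<not> circ_ord p z q \<Longrightarrow> g z = z"
proof -
  have "x \<noteq> p" "y \<noteq> p" "q \<noteq> p" using x y circ_ord_distinct by blast+
  then obtain x' y' s where eq: "x = chart p x'" "y = chart p y'" "q = chart p s"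
    by (metis chart_surj)
  then have "x' < s" "y' < s" using x y by (auto simp: circ_ord_chart)
  then obtain k where k: "k \<in> Aut_rat" "k x' = y'" "\<And>t. s \<le> t \<Longrightarrow> k t = t"
    using ray_homogeneous_rat by blast
  show thesis
  proof
    show "extend p k \<in> Aut_circle" using k(1) by (rule extend_Aut_circle)
    show "extend p k x = y" by (simp add: eq k)
    show "extend p k z = z" if z: "\<not> circ_ord p z q" for z
    proof (cases "z = p")
      case False
      then obtain t where t: "z = chart p t" by (metis chart_surj)
      with z have "s \<le> t" by (simp add: eq circ_ord_chart)
      then show ?thesis by (simp add: t k)
    qed simp
  qed
qed

lemma circ_ord_dense:
  assumes "p \<noteq> q"
  obtains x where "circ_ord p x q"
proof -
  obtain s where "q = chart p s" using assms chart_surj by metis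
  then have "circ_ord p (chart p (s - 1)) q" by (simp add: circ_ord_chart)
  then show thesis by (rule that)
qed

lemma arc_noncommuting:
  assumes "p \<noteq> q"
  obtains f g where "f \<in> Aut_circle" "g \<in> Aut_circle" "f \<circ> g \<noteq> g \<circ> f"
    "\<And>z. \<not> circ_ord p z q \<Longrightarrow> f z = z" "\<And>z. \<not> circ_ord p z q \<Longrightarrow> g z = z"
proof -
  obtain y where y: "circ_ord p y q" using assms by (rule circ_ord_dense)
  then have "p \<noteq> y" using circ_ord_distinct by blast
  then obtain x where x: "circ_ord p x y" by (rule circ_ord_dense)
  then have "p \<noteq> x" using circ_ord_distinct by blast
  then obtain w where w: "circ_ord p w x" by (rule circ_ord_dense)
  have xq: "circ_ord p x q" using x y by (rule circ_ord_trans)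
  have wy: "circ_ord p w y" using w x by (rule circ_ord_trans)
  obtain f where f: "f \<in> Aut_circle" "f x = w" "\<And>z. \<not> circ_ord p z y \<Longrightarrow> f z = z"
    using arc_homogeneous[OF x wy] by blast
  obtain g where g: "g \<in> Aut_circle" "g x = y" "\<And>z. \<not> circ_ord p z q \<Longrightarrow> g z = z"
    using arc_homogeneous[OF xq y] by blast
  \<comment> \<open>The maps are told apart at \<open>x\<close>: \<open>f (g x)\<close> is
    \<open>f y = y\<close>, whereas \<open>g (f x) = g w\<close> differs from \<open>y = g x\<close>
    by injectivity.\<close>
  have "f y = y" using f(3) circ_ord_distinct by blast
  moreover have "g w \<noteq> y" using g(1,2) Aut_circle_inj w circ_ord_distinct by metis
  ultimately have "(f \<circ> g) x \<noteq> (g \<circ> f) x" using f(2) g(2) by simp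
  then have "f \<circ> g \<noteq> g \<circ> f" by metis
  moreover have "f z = z" if "\<not> circ_ord p z q" for z
    using that f(3) y circ_ord_trans by blast
  ultimately show thesis using that f(1) g(1,3) by blast
qed

text \<open>Induction on \<open>F\<close>: a new point of the arc other than \<open>a\<close>
  becomes the new end point on its side of \<open>a\<close>.\<close>

lemma arc_around_avoiding:
  assumes "finite F"
  obtains p q where "circ_ord p a q" "\<And>z. circ_ord p z q \<Longrightarrow> z \<in> F \<Longrightarrow> z = a"
  using assms
proof (induction F arbitrary: thesis rule: finite_induct)
  case empty
  obtain p where "p \<noteq> a" by (metis chart_neq)
  then obtain q where "circ_ord a q p" by (metis circ_ord_dense)
  then show ?case using empty circ_ord_rotate by blast
next
  case (insert c F)
  obtain p q where pq: "circ_ord p a q" "\<And>z. circ_ord p z q \<Longrightarrow> z \<in> F \<Longrightarrow> z = a"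
    using insert.IH by blast
  consider "c = a \<or> \<not> circ_ord p c q" | "circ_ord p c q" "circ_ord p c a" | "circ_ord p c q" "circ_ord p a c"
    using pq(1) circ_ord_total circ_ord_distinct by metis
  then show ?case
  proof cases
    case 1
    then show ?thesis using pq insert.prems by blast
  next
    case 2
    have "z = a" if z: "circ_ord c z q" "z \<in> insert c F" for z
    proof -
      have "circ_ord p z q" using z(1) 2(1) unfolding circ_ord_pos by auto
      then show ?thesis using z pq(2) circ_ord_distinct by blast
    qed
    moreover have "circ_ord c a q" using 2 pq(1) unfolding circ_ord_pos by auto
    ultimately show ?thesis using insert.prems by blast
  next
    case 3
    have "z = a" if z: "circ_ord p z c" "z \<in> insert c F" for z
      using circ_ord_trans[OF z(1) 3(1)] z pq(2) circ_ord_distinct by blast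
    then show ?thesis using 3 insert.prems by blast
  qed
qed

section \<open>The pointwise topology\<close>

lemma openin_pointwise_topology:
  "openin (pointwise_topology A) U \<longleftrightarrow>
     U \<subseteq> A \<and> (\<forall>f\<in>U. \<exists>F. finite F \<and> (\<forall>g\<in>A. (\<forall>x\<in>F. g x = f x) \<longrightarrow> g \<in> U))"
  (is "?L \<longleftrightarrow> ?R")
proof
  assume ?L
  then obtain T where T: "U = T \<inter> A"
    and op: "openin (product_topology (\<lambda>_. discrete_topology UNIV) UNIV) T"
    unfolding pointwise_topology_def openin_subtopology by blast
  have "\<exists>F. finite F \<and> (\<forall>g\<in>A. (\<forall>x\<in>F. g x = f x) \<longrightarrow> g \<in> U)" if f: "f \<in> U" for f
  proof -
    have "f \<in> T" using f T by blast
    then obtain V where V: "finite {i. V i \<noteq> UNIV}" "\<And>i. f i \<in> V i" "Pi\<^sub>E UNIV V \<subseteq> T"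
      using op unfolding openin_product_topology_alt by (fastforce simp: PiE_iff)
    have "g \<in> U" if "g \<in> A" "\<forall>x\<in>{i. V i \<noteq> UNIV}. g x = f x" for g
    proof -
      have "g i \<in> V i" for i using that(2) V(2)[of i] by (cases "V i = UNIV") auto
      then have "g \<in> T" using V(3) by (auto simp: PiE_iff)
      then show ?thesis using that(1) T by blast
    qed
    then show ?thesis using V(1) by blast
  qed
  then show ?R using T by blast
next
  assume R: ?R
  define good where "good f F \<longleftrightarrow> finite F \<and> (\<forall>g\<in>A. (\<forall>x\<in>F. g x = f x) \<longrightarrow> g \<in> U)" for f F
  \<comment> \<open>An open set of the full product with trace \<open>U\<close> on \<open>A\<close>:
    the union of the finite-coordinate cylinders witnessing the assumption.\<close>
  define T where "T = {g. \<exists>f\<in>U. \<exists>F. good f F \<and> (\<forall>x\<in>F. g x = f x)}"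
  have "openin (product_topology (\<lambda>_. discrete_topology UNIV) UNIV) T"
    unfolding openin_product_topology_alt
  proof
    fix g assume "g \<in> T"
    then obtain f F where f: "f \<in> U" "good f F" "\<forall>x\<in>F. g x = f x" by (auto simp: T_def)
    let ?V = "\<lambda>i. if i \<in> F then {g i} else UNIV"
    have "{i. ?V i \<noteq> UNIV} \<subseteq> F" by auto
    then have "finite {i. ?V i \<noteq> UNIV}"
      using f(2) finite_subset unfolding good_def by blast
    moreover have "Pi\<^sub>E UNIV ?V \<subseteq> T"
    proof
      fix h assume "h \<in> Pi\<^sub>E UNIV ?V"
      then have "h x \<in> ?V x" for x by (auto simp: PiE_iff)
      then have "h x = g x" if "x \<in> F" for x using that by (metis singletonD)
      then show "h \<in> T" using f unfolding T_def by force
    qed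
    ultimately show "\<exists>V. finite {i \<in> UNIV. V i \<noteq> topspace (discrete_topology UNIV)} \<and>
        (\<forall>i\<in>UNIV. openin (discrete_topology UNIV) (V i)) \<and> g \<in> Pi\<^sub>E UNIV V \<and> Pi\<^sub>E UNIV V \<subseteq> T"
      by (intro exI[of _ ?V]) auto
  qed
  moreover have "U = T \<inter> A"
  proof
    show "U \<subseteq> T \<inter> A" using R unfolding T_def good_def by blast
    show "T \<inter> A \<subseteq> U" unfolding T_def good_def by blast
  qed
  ultimately show ?L unfolding pointwise_topology_def openin_subtopology by blast
qed

lemma topspace_pointwise_topology [simp]: "topspace (pointwise_topology A) = A"
  by (simp add: pointwise_topology_def)

lemma subtopology_pointwise_topology:
  "B \<subseteq> A \<Longrightarrow> subtopology (pointwise_topology A) B = pointwise_topology B"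
  by (simp add: pointwise_topology_def subtopology_subtopology inf_absorb2)

text \<open>Each coordinate of the image depends on a single coordinate of the argument, so a finite
  set of coordinates in \<open>B\<close> pulls back to a finite set in \<open>A\<close>.\<close>

lemma continuous_map_pointwise_topologyI:
  assumes "\<And>f. f \<in> A \<Longrightarrow> \<Phi> f \<in> B"
    and "\<And>y. \<exists>x. \<forall>f\<in>A. \<forall>g\<in>A. g x = f x \<longrightarrow> \<Phi> g y = \<Phi> f y"
  shows "continuous_map (pointwise_topology A) (pointwise_topology B) \<Phi>"
  unfolding continuous_map_def
proof (intro conjI allI impI)
  fix U assume U: "openin (pointwise_topology B) U"
  obtain d where d: "\<And>y f g. f \<in> A \<Longrightarrow> g \<in> A \<Longrightarrow> g (d y) = f (d y) \<Longrightarrow> \<Phi> g y = \<Phi> f y"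
    using assms(2) by metis
  have "\<exists>F. finite F \<and> (\<forall>g\<in>A. (\<forall>x\<in>F. g x = f x) \<longrightarrow> g \<in> {f \<in> A. \<Phi> f \<in> U})"
    if f: "f \<in> A" "\<Phi> f \<in> U" for f
  proof -
    obtain F where F: "finite F" "\<And>g. g \<in> B \<Longrightarrow> (\<forall>x\<in>F. g x = \<Phi> f x) \<Longrightarrow> g \<in> U"
      using U f(2) unfolding openin_pointwise_topology by meson
    have "\<Phi> g \<in> U" if g: "g \<in> A" "\<forall>x\<in>d ` F. g x = f x" for g
      using F(2)[of "\<Phi> g"] assms(1) g d[OF f(1) g(1)] by blast
    then show ?thesis using F(1) by (intro exI[of _ "d ` F"]) auto
  qed
  then show "openin (pointwise_topology A) {f \<in> topspace (pointwise_topology A). \<Phi> f \<in> U}"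
    unfolding openin_pointwise_topology by auto
qed (use assms(1) in auto)

section \<open>Point stabilizers\<close>

text \<open>Inverse to \<open>extend p\<close> on the stabilizer of \<open>p\<close>. Fixing
  \<open>p\<close> ensures that \<open>g (chart p t)\<close> stays in the range of the
  chart.\<close>

definition restrict_chart :: "rat_circle \<Rightarrow> (rat_circle \<Rightarrow> rat_circle) \<Rightarrow> rat \<Rightarrow> rat" where
  "restrict_chart p g t = unchart p (g (chart p t))"

lemma stabilizer_circle_subset: "stabilizer_circle p \<subseteq> Aut_circle"
  by (auto simp: stabilizer_circle_def)

lemma chart_restrict_chart:
  assumes "g \<in> stabilizer_circle p"
  shows "chart p (restrict_chart p g t) = g (chart p t)"
proof -
  have "g p = p" "g \<in> Aut_circle" using assms by (auto simp: stabilizer_circle_def)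
  then have "g (chart p t) \<noteq> p" by (metis Aut_circle_inj chart_neq)
  then show ?thesis by (simp add: restrict_chart_def chart_unchart)
qed

lemma restrict_chart_comp:
  assumes "f \<in> stabilizer_circle p" "g \<in> stabilizer_circle p"
  shows "restrict_chart p (f \<circ> g) = restrict_chart p f \<circ> restrict_chart p g"
  by (simp add: fun_eq_iff restrict_chart_def[of p f] chart_restrict_chart[OF assms(2)])
    (simp add: restrict_chart_def)

lemma restrict_chart_id: "restrict_chart p id = id"
  by (auto simp: restrict_chart_def)

text \<open>Restriction is multiplicative, so the restriction of the inverse of \<open>g\<close> is
  an inverse of the restriction; monotonicity is the preserved order cut at
  \<open>p\<close>.\<close>

lemma restrict_chart_Aut_rat:
  assumes g: "g \<in> stabilizer_circle p"
  shows "restrict_chart p g \<in> Aut_rat"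
proof -
  have gA: "g \<in> Aut_circle" "g p = p" using g by (auto simp: stabilizer_circle_def)
  let ?g' = "inv_into UNIV g"
  have "?g' p = p" using Aut_circle_inv(2)[OF gA(1), of p] gA(2) by simp
  then have g': "?g' \<in> stabilizer_circle p"
    using Aut_circle_closed(4)[OF gA(1)] by (simp add: stabilizer_circle_def)
  have "?g' \<circ> g = id" "g \<circ> ?g' = id"
    using Aut_circle_inv[OF gA(1)] by (auto simp: fun_eq_iff)
  then have "bij (restrict_chart p g)"
    using restrict_chart_comp[OF g g'] restrict_chart_comp[OF g' g]
    by (intro o_bij[of "restrict_chart p ?g'"]) (simp_all add: restrict_chart_id)
  moreover have "restrict_chart p g s < restrict_chart p g t" if "s < t" for s t
    using that Aut_circleD(2)[OF gA(1), of p "chart p s" "chart p t"] gA(2)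
    by (simp add: circ_ord_chart flip: chart_restrict_chart[OF g])
  ultimately show ?thesis by (simp add: Aut_rat_def strict_mono_mono strict_mono_def)
qed

lemma extend_stabilizer: "k \<in> Aut_rat \<Longrightarrow> extend p k \<in> stabilizer_circle p"
  by (simp add: stabilizer_circle_def extend_Aut_circle)

lemma restrict_chart_extend: "restrict_chart p (extend p k) = k"
  by (simp add: fun_eq_iff restrict_chart_def)

lemma extend_restrict_chart:
  assumes "g \<in> stabilizer_circle p"
  shows "extend p (restrict_chart p g) = g"
proof
  fix x
  show "extend p (restrict_chart p g) x = g x"
  proof (cases "x = p")
    case True
    then show ?thesis using assms by (simp add: stabilizer_circle_def)
  next
    case False
    then obtain t where "x = chart p t" by (rule chart_surj)
    then show ?thesis by (simp add: chart_restrict_chart[OF assms])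
  qed
qed

lemma homeomorphic_map_restrict_chart:
  "homeomorphic_map (pointwise_topology (stabilizer_circle p)) (pointwise_topology Aut_rat)
     (restrict_chart p)"
proof -
  have "continuous_map (pointwise_topology (stabilizer_circle p)) (pointwise_topology Aut_rat)
     (restrict_chart p)"
  proof (rule continuous_map_pointwise_topologyI)
    fix t
    show "\<exists>x. \<forall>f\<in>stabilizer_circle p. \<forall>g\<in>stabilizer_circle p.
        g x = f x \<longrightarrow> restrict_chart p g t = restrict_chart p f t"
      by (intro exI[of _ "chart p t"]) (simp add: restrict_chart_def)
  qed (rule restrict_chart_Aut_rat)
  moreover have "continuous_map (pointwise_topology Aut_rat)
     (pointwise_topology (stabilizer_circle p)) (extend p)"
  proof (rule continuous_map_pointwise_topologyI)
    fix x
    show "\<exists>t. \<forall>f\<in>Aut_rat. \<forall>g\<in>Aut_rat. g t = f t \<longrightarrow> extend p g x = extend p f x"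
      by (intro exI[of _ "unchart p x"]) (simp add: extend_def)
  qed (rule extend_stabilizer)
  ultimately have "homeomorphic_maps (pointwise_topology (stabilizer_circle p))
      (pointwise_topology Aut_rat) (restrict_chart p) (extend p)"
    by (simp add: homeomorphic_maps_def restrict_chart_extend extend_restrict_chart)
  then show ?thesis using homeomorphic_map_maps by blast
qed

lemma topologically_isomorphic_stabilizer_circle:
  "topologically_isomorphic (permutation_group Aut_circle\<lparr>carrier := stabilizer_circle p\<rparr>)
     (subtopology (pointwise_topology Aut_circle) (stabilizer_circle p))
     (permutation_group Aut_rat) (pointwise_topology Aut_rat)"
  unfolding topologically_isomorphic_def subtopology_pointwise_topology[OF stabilizer_circle_subset]
proof (rule bexI[where x = "restrict_chart p"])
  note ps = permutation_group_simps[OF Aut_circle_closed(1)]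
    permutation_group_simps[OF Aut_rat_closed(1)]
  have "bij_betw (restrict_chart p) (stabilizer_circle p) Aut_rat"
    by (rule bij_betw_byWitness[of _ "extend p"])
      (auto simp: restrict_chart_extend extend_restrict_chart restrict_chart_Aut_rat
        extend_stabilizer)
  moreover have "f \<in> Aut_circle" if "f \<in> stabilizer_circle p" for f
    using that stabilizer_circle_subset by blast
  ultimately show "restrict_chart p \<in>
      iso (permutation_group Aut_circle\<lparr>carrier := stabilizer_circle p\<rparr>) (permutation_group Aut_rat)"
    by (auto simp: iso_def hom_def ps restrict_chart_Aut_rat restrict_chart_comp)
qed (rule homeomorphic_map_restrict_chart)

lemma openin_stabilizer_circle:
  "openin (pointwise_topology Aut_circle) (stabilizer_circle p)"
  unfolding openin_pointwise_topology
  by (auto simp: stabilizer_circle_def intro!: exI[of _ "{p}"])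

section \<open>The topology of pointwise convergence on the rational circle\<close>

definition circ_nbhd :: "rat_circle \<Rightarrow> rat_circle \<Rightarrow> rat_circle \<Rightarrow> (rat_circle \<Rightarrow> rat_circle) set" where
  "circ_nbhd a x b = {f \<in> Aut_circle. circ_ord a (f x) b}"

text \<open>Open arcs form a base of the usual topology of the rational circle, so these sets are a
  subbase of pointwise convergence with respect to it.\<close>

definition circ_topology :: "(rat_circle \<Rightarrow> rat_circle) topology" where
  "circ_topology = topology_generated_by {circ_nbhd a x b | a x b. True}"

lemma openin_circ_nbhd: "openin circ_topology (circ_nbhd a x b)"
  unfolding circ_topology_def by (rule topology_generated_by_Basis) blast

lemma arc_around: obtains p q where "circ_ord p a q"
  using arc_around_avoiding[of "{}"] by blast

lemma topspace_circ_topology: "topspace circ_topology = Aut_circle"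
proof
  show "Aut_circle \<subseteq> topspace circ_topology"
  proof
    fix f :: "rat_circle \<Rightarrow> rat_circle" assume f: "f \<in> Aut_circle"
    \<comment> \<open>Any point could be evaluated here; \<open>undefined\<close> is an arbitrary
      one.\<close>
    obtain a b where "circ_ord a (f undefined) b" by (rule arc_around)
    then have "f \<in> circ_nbhd a undefined b" using f by (simp add: circ_nbhd_def)
    then show "f \<in> topspace circ_topology" using openin_circ_nbhd openin_subset by blast
  qed
qed (auto simp: circ_topology_def topology_generated_by_topspace circ_nbhd_def)

lemma continuous_map_circ_topologyI:
  assumes "\<And>p. p \<in> topspace X \<Longrightarrow> \<Phi> p \<in> Aut_circle"
    and "\<And>p a x b. p \<in> topspace X \<Longrightarrow> circ_ord a (\<Phi> p x) b \<Longrightarrow>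
      \<exists>U. openin X U \<and> p \<in> U \<and> (\<forall>q\<in>U. circ_ord a (\<Phi> q x) b)"
  shows "continuous_map X circ_topology \<Phi>"
  unfolding circ_topology_def
proof (rule continuous_on_generated_topo)
  show "\<Phi> ` topspace X \<subseteq> \<Union> {circ_nbhd a x b |a x b. True}"
    using assms(1) topspace_circ_topology
    by (auto simp: circ_topology_def topology_generated_by_topspace)
  fix U assume "U \<in> {circ_nbhd a x b |a x b. True}"
  then obtain a x b where U: "U = circ_nbhd a x b" by blast
  show "openin X (\<Phi> -` U \<inter> topspace X)"
  proof (subst openin_subopen, safe)
    fix p assume p: "p \<in> topspace X" "\<Phi> p \<in> U"
    then obtain V where V: "openin X V" "p \<in> V" "\<And>q. q \<in> V \<Longrightarrow> circ_ord a (\<Phi> q x) b"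
      using assms(2)[OF p(1), of a x b] by (auto simp: U circ_nbhd_def)
    then show "\<exists>T. openin X T \<and> p \<in> T \<and> T \<subseteq> \<Phi> -` U \<inter> topspace X"
      using openin_subset[OF V(1)] assms(1) by (intro exI[of _ V]) (auto simp: U circ_nbhd_def)
  qed
qed

text \<open>If \<open>f x\<close> and \<open>g x\<close> differ, points \<open>a\<close> and
  \<open>b\<close> chosen between them on either side cut the circle into two disjoint arcs, one
  around each.\<close>

lemma Hausdorff_circ_topology: "Hausdorff_space circ_topology"
  unfolding Hausdorff_space_def topspace_circ_topology
proof (intro allI impI, elim conjE)
  fix f g assume fg: "f \<in> Aut_circle" "g \<in> Aut_circle" "f \<noteq> g"
  then obtain x where x: "f x \<noteq> g x" by blast
  obtain a where a: "circ_ord (f x) a (g x)" using x by (rule circ_ord_dense)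
  obtain b where b: "circ_ord (g x) b (f x)" using x[symmetric] by (rule circ_ord_dense)
  have "f \<in> circ_nbhd b x a" "g \<in> circ_nbhd a x b"
    using fg circ_ord_trans_left[OF circ_ord_rotate[OF b] a]
      circ_ord_trans_left[OF circ_ord_rotate[OF a] b]
    by (simp_all add: circ_nbhd_def)
  moreover have "\<not> (circ_ord b y a \<and> circ_ord a y b)" for y
    using circ_ord_asym circ_ord_rotate by metis
  then have "disjnt (circ_nbhd b x a) (circ_nbhd a x b)"
    by (simp add: disjnt_iff circ_nbhd_def)
  ultimately show "\<exists>U V. openin circ_topology U \<and> openin circ_topology V \<and>
      f \<in> U \<and> g \<in> V \<and> disjnt U V"
    using openin_circ_nbhd by blast
qed

text \<open>Monotonicity supplies the uniformity needed for joint continuity: controlling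
  \<open>f'\<close> at the two ends \<open>a'\<close> and \<open>b'\<close> controls it on the whole
  arc between them, where \<open>g' x\<close> lies.\<close>

lemma continuous_map_comp_circ_topology:
  "continuous_map (prod_topology circ_topology circ_topology) circ_topology (\<lambda>(f, g). f \<circ> g)"
proof (rule continuous_map_circ_topologyI)
  fix p a x b assume "p \<in> topspace (prod_topology circ_topology circ_topology)"
    "circ_ord a ((case p of (f, g) \<Rightarrow> f \<circ> g) x) b"
  then obtain f g where p: "p = (f, g)" and f: "f \<in> Aut_circle" and g: "g \<in> Aut_circle"
    and ord: "circ_ord a (f (g x)) b"
    by (auto simp: topspace_circ_topology)
  let ?y = "g x"
  have "a \<noteq> f ?y" "f ?y \<noteq> b" using ord circ_ord_distinct by blast+
  then obtain a' b' where a': "circ_ord a (f a') (f ?y)" and b': "circ_ord (f ?y) (f b') b"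
    by (metis Aut_circle_inv(1)[OF f] circ_ord_dense)
  have "circ_ord (f a') (f ?y) (f b')"
    by (intro circ_ord_trans_left[OF circ_ord_rotate[OF a']]
        circ_ord_rotate[OF circ_ord_trans_left[OF ord b']])
  then have y: "circ_ord a' ?y b'" by (simp add: Aut_circleD(2)[OF f])
  let ?U = "(circ_nbhd a a' (f ?y) \<inter> circ_nbhd (f ?y) b' b) \<times> circ_nbhd a' x b'"
  have "circ_ord a (f' (g' x)) b" if "(f', g') \<in> ?U" for f' g'
  proof -
    have "f' \<in> Aut_circle" "circ_ord a (f' a') (f ?y)" "circ_ord (f ?y) (f' b') b"
      "circ_ord a' (g' x) b'"
      using that by (auto simp: circ_nbhd_def)
    moreover from this have "circ_ord (f' a') (f' (g' x)) (f' b')" by (simp add: Aut_circleD(2))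
    ultimately show ?thesis using ord circ_ord_arc_subset by blast
  qed
  moreover have "openin (prod_topology circ_topology circ_topology) ?U"
    by (simp add: openin_prod_Times_iff openin_circ_nbhd openin_Int)
  moreover have "p \<in> ?U" using f g a' b' y by (simp add: p circ_nbhd_def)
  ultimately show "\<exists>U. openin (prod_topology circ_topology circ_topology) U \<and> p \<in> U \<and>
      (\<forall>q\<in>U. circ_ord a ((case q of (f, g) \<Rightarrow> f \<circ> g) x) b)"
    by (intro exI[of _ ?U]) auto
qed (auto simp: topspace_circ_topology Aut_circle_closed(3))

lemma continuous_map_inv_circ_topology:
  "continuous_map circ_topology circ_topology (inv_into UNIV)"
proof (rule continuous_map_circ_topologyI)
  fix f a x b assume "f \<in> topspace circ_topology" and ord: "circ_ord a (inv_into UNIV f x) b"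
  then have f: "f \<in> Aut_circle" by (simp add: topspace_circ_topology)
  have x: "circ_ord (f a) x (f b)"
    using ord Aut_circleD(2)[OF f, of a "inv_into UNIV f x" b] by (simp add: Aut_circle_inv(1)[OF f])
  then have "f b \<noteq> f a" using circ_ord_distinct by metis
  \<comment> \<open>The inverse of \<open>g\<close> sends \<open>x\<close> between \<open>a\<close>
    and \<open>b\<close> iff \<open>x\<close> lies between \<open>g a\<close> and
    \<open>g b\<close>. The point \<open>c\<close>, on the far side of \<open>x\<close>, makes this
    two independent conditions on \<open>g a\<close> and \<open>g b\<close>.\<close>
  then obtain c where c: "circ_ord (f b) c (f a)" by (rule circ_ord_dense)
  let ?U = "circ_nbhd c a x \<inter> circ_nbhd x b c"
  have "circ_ord a (inv_into UNIV g x) b" if "g \<in> ?U" for g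
  proof -
    have g: "g \<in> Aut_circle" "circ_ord c (g a) x" "circ_ord x (g b) c"
      using that by (auto simp: circ_nbhd_def)
    have "circ_ord (g a) (g (inv_into UNIV g x)) (g b)"
      unfolding Aut_circle_inv(1)[OF g(1)]
      using circ_ord_rotate[OF g(2)] g(3) by (rule circ_ord_trans_left)
    then show ?thesis by (simp add: Aut_circleD(2)[OF g(1)])
  qed
  moreover have "f \<in> ?U"
    using f circ_ord_trans_left[OF circ_ord_rotate[OF c] x]
      circ_ord_trans_left[OF circ_ord_rotate[OF x] c]
    by (simp add: circ_nbhd_def)
  ultimately show "\<exists>U. openin circ_topology U \<and> f \<in> U \<and>
      (\<forall>g\<in>U. circ_ord a (inv_into UNIV g x) b)"
    by (intro exI[of _ ?U]) (auto simp: openin_circ_nbhd openin_Int)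
qed (simp add: topspace_circ_topology Aut_circle_closed(4))

section \<open>Group topologies on the automorphism group; the arc topology is one of the coarser
  ones\<close>

lemma group_Aut_circle: "group (permutation_group Aut_circle)"
  using hausdorff_topological_group_Aut_circle
  by (simp add: hausdorff_topological_group_def topological_group_def)

lemma inv_permutation_group_Aut_circle:
  assumes "f \<in> Aut_circle"
  shows "inv\<^bsub>permutation_group Aut_circle\<^esub> f = inv_into UNIV f"
proof -
  note ps = permutation_group_simps[OF Aut_circle_closed(1)]
  interpret group "permutation_group Aut_circle" by (rule group_Aut_circle)
  have "inv_into UNIV f \<circ> f = id" using Aut_circle_inv(2)[OF assms] by auto
  then show ?thesis
    by (intro inv_equality) (use assms Aut_circle_closed(4) in \<open>auto simp: ps\<close>)
qed

lemma topological_group_Aut_circle_iff: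
  "topological_group (permutation_group Aut_circle) \<sigma> \<longleftrightarrow>
     topspace \<sigma> = Aut_circle \<and>
     continuous_map (prod_topology \<sigma> \<sigma>) \<sigma> (\<lambda>(f, g). f \<circ> g) \<and>
     continuous_map \<sigma> \<sigma> (inv_into UNIV)"
proof (cases "topspace \<sigma> = Aut_circle")
  case True
  note ps = permutation_group_simps[OF Aut_circle_closed(1)]
  have "continuous_map (prod_topology \<sigma> \<sigma>) \<sigma> (\<lambda>(f, g). f \<otimes>\<^bsub>permutation_group Aut_circle\<^esub> g) \<longleftrightarrow>
      continuous_map (prod_topology \<sigma> \<sigma>) \<sigma> (\<lambda>(f, g). f \<circ> g)"
    by (rule iffI; erule continuous_map_eq) (auto simp: True ps)
  moreover have "continuous_map \<sigma> \<sigma> (\<lambda>f. inv\<^bsub>permutation_group Aut_circle\<^esub> f) \<longleftrightarrow>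
      continuous_map \<sigma> \<sigma> (inv_into UNIV)"
    by (rule iffI; erule continuous_map_eq) (auto simp: True inv_permutation_group_Aut_circle)
  ultimately show ?thesis by (simp add: topological_group_def group_Aut_circle ps True)
qed (simp add: topological_group_def permutation_group_simps[OF Aut_circle_closed(1)])

lemma circ_topology_coarser:
  "circ_topology \<in>
     coarser_hausdorff_topologies (permutation_group Aut_circle) (pointwise_topology Aut_circle)"
proof -
  have "continuous_map (pointwise_topology Aut_circle) circ_topology (\<lambda>f. f)"
  proof (rule continuous_map_circ_topologyI)
    fix f a x b assume "f \<in> topspace (pointwise_topology Aut_circle)" "circ_ord a (f x) b"
    then show "\<exists>U. openin (pointwise_topology Aut_circle) U \<and> f \<in> U \<and> (\<forall>g\<in>U. circ_ord a (g x) b)"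
      by (intro exI[of _ "circ_nbhd a x b"])
        (auto simp: circ_nbhd_def openin_pointwise_topology intro!: exI[of _ "{x}"])
  qed simp
  then have "openin (pointwise_topology Aut_circle) U" if "openin circ_topology U" for U
    using openin_continuous_map_preimage[OF _ that] openin_subset[OF that]
    by (fastforce simp: topspace_circ_topology Collect_conj_eq inf_absorb2)
  then show ?thesis
    by (simp add: coarser_hausdorff_topologies_def hausdorff_topological_group_def
        topological_group_Aut_circle_iff topspace_circ_topology Hausdorff_circ_topology
        continuous_map_comp_circ_topology continuous_map_inv_circ_topology)
qed

section \<open>Small rotations and the failure of co-minimality\<close>

lemma circ_topology_small_rotations:
  assumes "openin circ_topology U" "f \<in> U"
  shows "\<exists>e>0. \<forall>t. 0 < t \<and> t < e \<longrightarrow> circ_rot t \<circ> f \<in> U"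
proof -
  \<comment> \<open>The sets stable under sufficiently small positive rotations at each of their
    members form a topology; it contains the subbase, hence every open set.\<close>
  define T where "T V \<longleftrightarrow> (\<forall>f\<in>V. \<exists>e>0. \<forall>t. 0 < t \<and> t < e \<longrightarrow> circ_rot t \<circ> f \<in> V)"
    for V :: "(rat_circle \<Rightarrow> rat_circle) set"
  have "istopology T"
    unfolding istopology_def
  proof (intro conjI allI impI)
    fix V W assume VW: "T V" "T W"
    show "T (V \<inter> W)"
      unfolding T_def
    proof
      fix f assume "f \<in> V \<inter> W"
      then obtain d e where "0 < d" "\<forall>t. 0 < t \<and> t < d \<longrightarrow> circ_rot t \<circ> f \<in> V"
        "0 < e" "\<forall>t. 0 < t \<and> t < e \<longrightarrow> circ_rot t \<circ> f \<in> W"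
        using VW unfolding T_def by blast
      then show "\<exists>e>0. \<forall>t. 0 < t \<and> t < e \<longrightarrow> circ_rot t \<circ> f \<in> V \<inter> W"
        by (intro exI[of _ "min d e"]) auto
    qed
  next
    fix K assume K: "\<forall>V\<in>K. T V"
    show "T (\<Union>K)"
      unfolding T_def
    proof
      fix f assume "f \<in> \<Union>K"
      then obtain V where V: "V \<in> K" "f \<in> V" by blast
      then have "\<exists>e>0. \<forall>t. 0 < t \<and> t < e \<longrightarrow> circ_rot t \<circ> f \<in> V" using K unfolding T_def by blast
      then show "\<exists>e>0. \<forall>t. 0 < t \<and> t < e \<longrightarrow> circ_rot t \<circ> f \<in> \<Union>K" using V(1) by blast
    qed
  qed
  moreover have "T V" if Vin: "V \<in> {circ_nbhd a x b |a x b. True}" for V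
    unfolding T_def
  proof
    fix f assume f: "f \<in> V"
    obtain a x b where V: "V = circ_nbhd a x b" using Vin by blast
    then obtain u v w :: rat where uvw: "a = abs_rat_circle u" "f x = abs_rat_circle v"
        "b = abs_rat_circle w" "u < v" "v < w" "w < u + 1" and fA: "f \<in> Aut_circle"
      using f by (auto simp: circ_nbhd_def circ_ord_def)
    have "circ_rot t \<circ> f \<in> V" if t: "0 < t" "t < w - v" for t
    proof -
      have "circ_ord a (circ_rot t (f x)) b"
        unfolding circ_ord_def
        by (intro exI[of _ u] exI[of _ "v + t"] exI[of _ w])
          (use uvw t in \<open>auto simp: circ_rot_abs\<close>)
      then show ?thesis by (simp add: V circ_nbhd_def Aut_circle_closed(3) circ_rot_Aut fA)
    qed
    then show "\<exists>e>0. \<forall>t. 0 < t \<and> t < e \<longrightarrow> circ_rot t \<circ> f \<in> V"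
      using uvw(5) by (intro exI[of _ "w - v"]) auto
  qed
  moreover have "generate_topology_on {circ_nbhd a x b |a x b. True} U"
    using assms(1) by (simp add: circ_topology_def openin_topology_generated_by_iff)
  ultimately have "T U" by (rule generate_topology_on_coarsest)
  then show ?thesis using assms(2) by (simp add: T_def)
qed

lemma not_openin_circ_topology_stabilizer:
  "\<not> openin circ_topology (stabilizer_circle p)"
proof
  assume "openin circ_topology (stabilizer_circle p)"
  moreover have "id \<in> stabilizer_circle p"
    using Aut_circle_closed(2) by (simp add: stabilizer_circle_def)
  ultimately obtain e :: rat where e: "0 < e"
    "\<And>t. 0 < t \<Longrightarrow> t < e \<Longrightarrow> circ_rot t \<circ> id \<in> stabilizer_circle p"
    using circ_topology_small_rotations by metis
  \<comment> \<open>The bound 1/2 keeps \<open>t\<close> strictly between 0 and 1, so it is not an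
    integer and the rotation moves \<open>p\<close>.\<close>
  define t where "t = min (e / 2) (1 / 2)"
  have t: "0 < t" "t < e" "t < 1" using e(1) by (auto simp: t_def)
  then have "circ_rot t p = p" using e(2) by (simp add: stabilizer_circle_def)
  then have "abs_rat_circle (rep_rat_circle p + t) = abs_rat_circle (rep_rat_circle p)"
    by (simp add: circ_rot_def abs_rat_circle_rep)
  then have "t \<in> \<int>" by (simp add: rat_circle.abs_eq_iff)
  then obtain n where n: "t = of_int n" by (auto elim: Ints_cases)
  then have "0 < n" "n < 1" using t(1,3) by auto
  then show False by linarith
qed

text \<open>The two quotient topologies differ at the single coset \<open>H\<close>: its preimage is
  \<open>H\<close> itself, which is open pointwise but not in the arc topology.\<close>

lemma not_co_minimal_stabilizer_circle:
  "\<not> co_minimal (permutation_group Aut_circle) (pointwise_topology Aut_circle) (stabilizer_circle p)"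
proof
  let ?G = "permutation_group Aut_circle" and ?H = "stabilizer_circle p"
  assume "co_minimal ?G (pointwise_topology Aut_circle) ?H"
  then have eq: "coset_topology ?G circ_topology ?H =
      coset_topology ?G (pointwise_topology Aut_circle) ?H"
    using circ_topology_coarser by (auto simp: co_minimal_def)
  note ps = permutation_group_simps[OF Aut_circle_closed(1)]
  interpret group ?G by (rule group_Aut_circle)
  have sub: "subgroup ?H ?G" by (rule subgroup_stabilizer_circle)
  have eqH: "g <#\<^bsub>?G\<^esub> ?H = ?H" if "g \<in> ?H" for g
    using that sub subgroup.subset[OF sub] coset_join3 by blast
  then have lc: "{?H} \<subseteq> lcosets\<^bsub>?G\<^esub> ?H"
    using subgroup.one_closed[OF sub] by (force simp: LCOSETS_def)
  have "{g \<in> carrier ?G. g <#\<^bsub>?G\<^esub> ?H \<in> {?H}} = ?H"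
  proof
    show "{g \<in> carrier ?G. g <#\<^bsub>?G\<^esub> ?H \<in> {?H}} \<subseteq> ?H"
      using lcos_self[OF _ sub] by auto
    show "?H \<subseteq> {g \<in> carrier ?G. g <#\<^bsub>?G\<^esub> ?H \<in> {?H}}"
      using subgroup.subset[OF sub] eqH by auto
  qed
  then have "openin (coset_topology ?G circ_topology ?H) {?H} \<longleftrightarrow> openin circ_topology ?H"
    "openin (coset_topology ?G (pointwise_topology Aut_circle) ?H) {?H}"
    using lc openin_stabilizer_circle
    by (simp_all add: openin_coset_topology topspace_circ_topology ps)
  then show False using eq not_openin_circ_topology_stabilizer by metis
qed

section \<open>Coarser group topologies\<close>

lemma circ_ord_arc_split:
  assumes "circ_ord p w q" "circ_ord p a q" "w \<noteq> a"
  shows "circ_ord p w a \<or> circ_ord a w q"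
proof -
  have "circ_ord p w a \<or> circ_ord p a w"
    using circ_ord_total[of p w a] circ_ord_distinct[OF assms(1)] circ_ord_distinct[OF assms(2)]
      assms(3) by auto
  then show ?thesis using circ_ord_chain[OF _ assms(1)] by blast
qed

text \<open>The condition on \<open>c\<close> excludes automorphisms like a half turn, which move \<open>a\<close> to the same
  side as their inverses do.\<close>

lemma inv_moves_opposite:
  assumes v: "v \<in> Aut_circle" and a: "circ_ord p a q"
    and iva: "circ_ord p (inv_into UNIV v a) q"
    and c: "circ_ord q c p" and vc: "circ_ord q (v c) p"
  shows "circ_ord a (v a) q \<Longrightarrow> circ_ord p (inv_into UNIV v a) a"
    and "circ_ord p (v a) a \<Longrightarrow> circ_ord a (inv_into UNIV v a) q"
proof -
  let ?w = "inv_into UNIV v a"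
  have vw: "v ?w = a" by (rule Aut_circle_inv(1)[OF v])
  have pres: "circ_ord (v x) (v y) (v z)" if "circ_ord x y z" for x y z
    using that by (simp add: Aut_circleD(2)[OF v])
  have side: "circ_ord p ?w a \<or> circ_ord a ?w q" if "v a \<noteq> a"
    using circ_ord_arc_split[OF iva a] that vw by metis
  have out: "circ_ord a q x" "circ_ord p a x" if "circ_ord q x p" for x
  proof -
    have qpa: "circ_ord q p a" using a by (rule circ_ord_rotate_back)
    show "circ_ord a q x"
      using circ_ord_trans[OF that qpa] by (rule circ_ord_rotate_back)
    show "circ_ord p a x"
      using circ_ord_chain[OF that qpa] by (rule circ_ord_rotate)
  qed
  {
    assume va: "circ_ord a (v a) q"
    show "circ_ord p ?w a"
    proof (rule ccontr)
      assume "\<not> circ_ord p ?w a"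
      then have "circ_ord a ?w q" using side circ_ord_distinct[OF va] by auto
      \<comment> \<open>If \<open>?w\<close> and \<open>v a\<close> were both on this side of
        \<open>a\<close>, applying \<open>v\<close> to the order of \<open>a\<close>,
        \<open>?w\<close>, \<open>c\<close> would reverse the order of \<open>a\<close> and
        \<open>v a\<close> as seen from \<open>v c\<close>.\<close>
      then have "circ_ord a ?w c" using out(1)[OF c] by (rule circ_ord_trans)
      then have "circ_ord (v a) a (v c)" using pres vw by metis
      moreover have "circ_ord a (v a) (v c)" using va out(1)[OF vc] by (rule circ_ord_trans)
      ultimately show False using circ_ord_asym circ_ord_rotate by metis
    qed
  next
    assume va: "circ_ord p (v a) a"
    show "circ_ord a ?w q"
    proof (rule ccontr)
      assume "\<not> circ_ord a ?w q"
      then have "circ_ord p ?w a" using side circ_ord_distinct[OF va] by auto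
      then have "circ_ord ?w a c" using out(2)[OF c] by (rule circ_ord_chain)
      then have "circ_ord a (v a) (v c)" using pres vw by metis
      moreover have "circ_ord (v a) a (v c)" using va out(2)[OF vc] by (rule circ_ord_chain)
      ultimately show False using circ_ord_asym circ_ord_rotate by metis
    qed
  }
qed

section \<open>Identity neighbourhoods in a coarser group topology\<close>

definition id_nbhd :: "('a \<Rightarrow> 'a) topology \<Rightarrow> ('a \<Rightarrow> 'a) set \<Rightarrow> bool" where
  "id_nbhd \<sigma> U \<longleftrightarrow> openin \<sigma> U \<and> id \<in> U"

lemma id_nbhd_Int: "id_nbhd \<sigma> U \<Longrightarrow> id_nbhd \<sigma> V \<Longrightarrow> id_nbhd \<sigma> (U \<inter> V)"
  by (simp add: id_nbhd_def openin_Int)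

locale coarser_circle_topology =
  fixes \<sigma> :: "(rat_circle \<Rightarrow> rat_circle) topology"
  assumes coarser: "\<sigma> \<in>
    coarser_hausdorff_topologies (permutation_group Aut_circle) (pointwise_topology Aut_circle)"
begin

lemma topspace: "topspace \<sigma> = Aut_circle"
  and continuous_map_comp: "continuous_map (prod_topology \<sigma> \<sigma>) \<sigma> (\<lambda>(f, g). f \<circ> g)"
  and continuous_map_inv: "continuous_map \<sigma> \<sigma> (inv_into UNIV)"
  and Hausdorff: "Hausdorff_space \<sigma>"
  and openin_pointwise: "\<And>U. openin \<sigma> U \<Longrightarrow> openin (pointwise_topology Aut_circle) U"
  using coarser
  by (auto simp: coarser_hausdorff_topologies_def hausdorff_topological_group_def
      topological_group_Aut_circle_iff)

lemma continuous_map_mult: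
  assumes "continuous_map X \<sigma> f" "continuous_map X \<sigma> g"
  shows "continuous_map X \<sigma> (\<lambda>x. f x \<circ> g x)"
  using continuous_map_compose[OF continuous_map_pairedI[OF assms] continuous_map_comp]
  by (rule continuous_map_eq) auto

lemma continuous_map_const_Aut: "g \<in> Aut_circle \<Longrightarrow> continuous_map X \<sigma> (\<lambda>x. g)"
  by (simp add: topspace)

lemma continuous_map_self: "continuous_map \<sigma> \<sigma> (\<lambda>f. f)"
  using continuous_map_id[of \<sigma>] by (simp add: id_def)

lemma id_nbhd_subset: "id_nbhd \<sigma> U \<Longrightarrow> U \<subseteq> Aut_circle"
  using openin_subset topspace unfolding id_nbhd_def by metis

lemma id_nbhd_mult2:
  assumes "id_nbhd \<sigma> U"
  obtains V where "id_nbhd \<sigma> V" "\<And>f g. f \<in> V \<Longrightarrow> g \<in> V \<Longrightarrow> f \<circ> g \<in> U"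
proof -
  define P where "P = {p \<in> topspace (prod_topology \<sigma> \<sigma>). (\<lambda>(f, g). f \<circ> g) p \<in> U}"
  have op: "openin (prod_topology \<sigma> \<sigma>) P"
    unfolding P_def using assms
    by (intro openin_continuous_map_preimage[OF continuous_map_comp]) (simp add: id_nbhd_def)
  have "(id, id) \<in> P"
    using assms Aut_circle_closed(2) by (simp add: P_def topspace id_nbhd_def)
  with op[unfolded openin_prod_topology_alt, rule_format, of id id]
  obtain V W where VW: "openin \<sigma> V" "openin \<sigma> W" "id \<in> V" "id \<in> W" "V \<times> W \<subseteq> P"
    by metis
  have "f \<circ> g \<in> U" if "f \<in> V" "g \<in> W" for f g
    using VW(5) that by (auto simp: P_def)
  then show thesis
    using VW by (intro that[of "V \<inter> W"]) (auto simp: id_nbhd_def openin_Int)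
qed

lemma id_nbhd_mult3:
  assumes "id_nbhd \<sigma> U"
  obtains V where "id_nbhd \<sigma> V" "\<And>f. f \<in> V \<Longrightarrow> inv_into UNIV f \<in> V"
    "\<And>f g h. f \<in> V \<Longrightarrow> g \<in> V \<Longrightarrow> h \<in> V \<Longrightarrow> f \<circ> g \<circ> h \<in> U"
proof -
  obtain V1 where V1: "id_nbhd \<sigma> V1" "\<And>f g. f \<in> V1 \<Longrightarrow> g \<in> V1 \<Longrightarrow> f \<circ> g \<in> U"
    using assms by (rule id_nbhd_mult2) blast
  obtain V2 where V2: "id_nbhd \<sigma> V2" "\<And>f g. f \<in> V2 \<Longrightarrow> g \<in> V2 \<Longrightarrow> f \<circ> g \<in> V1"
    using V1(1) by (rule id_nbhd_mult2) blast
  \<comment> \<open>Intersecting with the preimage under inversion makes the neighbourhood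
    symmetric.\<close>
  let ?I = "{f \<in> topspace \<sigma>. inv_into UNIV f \<in> V2}"
  have "openin \<sigma> ?I"
    using V2(1) by (intro openin_continuous_map_preimage[OF continuous_map_inv])
      (simp add: id_nbhd_def)
  then have nb: "id_nbhd \<sigma> (V2 \<inter> ?I)"
    using V2(1) Aut_circle_closed(2) by (simp add: id_nbhd_def openin_Int topspace)
  show thesis
  proof (rule that[OF nb])
    fix f assume f: "f \<in> V2 \<inter> ?I"
    then have "bij f" using Aut_circleD(1) by (simp add: topspace)
    then show "inv_into UNIV f \<in> V2 \<inter> ?I"
      using f Aut_circle_closed(4) by (auto simp: topspace inv_inv_eq)
  next
    fix f g h assume fgh: "f \<in> V2 \<inter> ?I" "g \<in> V2 \<inter> ?I" "h \<in> V2 \<inter> ?I"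
    have "id \<in> V2" using V2(1) by (simp add: id_nbhd_def)
    then have "h \<in> V1" using V2(2)[of h id] fgh by simp
    moreover have "f \<circ> g \<in> V1" using V2(2) fgh by blast
    ultimately show "f \<circ> g \<circ> h \<in> U" using V1(2) by blast
  qed
qed

lemma id_nbhd_conj:
  assumes "id_nbhd \<sigma> U" and g: "g \<in> Aut_circle"
  shows "id_nbhd \<sigma> {f \<in> Aut_circle. inv_into UNIV g \<circ> f \<circ> g \<in> U}"
proof -
  have "continuous_map \<sigma> \<sigma> (\<lambda>f. inv_into UNIV g \<circ> f \<circ> g)"
    by (intro continuous_map_mult continuous_map_const_Aut continuous_map_self g
        Aut_circle_closed(4))
  from openin_continuous_map_preimage[OF this, of U]
  show ?thesis
    using assms Aut_circle_closed(2) Aut_circle_inv(2)[OF g]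
    by (auto simp: id_nbhd_def topspace o_def id_def)
qed

text \<open>This is where coarseness enters: \<open>U\<close> is also a pointwise neighbourhood of
  the identity.\<close>

lemma id_nbhd_finite_support:
  assumes "id_nbhd \<sigma> U"
  obtains F where "finite F" "\<And>g. g \<in> Aut_circle \<Longrightarrow> (\<And>x. x \<in> F \<Longrightarrow> g x = x) \<Longrightarrow> g \<in> U"
proof -
  have "openin (pointwise_topology Aut_circle) U" "id \<in> U"
    using assms openin_pointwise by (auto simp: id_nbhd_def)
  then obtain F where "finite F" "\<forall>g\<in>Aut_circle. (\<forall>x\<in>F. g x = id x) \<longrightarrow> g \<in> U"
    unfolding openin_pointwise_topology by blast
  then show thesis using that by auto
qed

text \<open>Left translations are homeomorphisms, so openness at \<open>g\<close> can be tested by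
  neighbourhoods of the identity.\<close>

lemma openinI:
  assumes U: "U \<subseteq> Aut_circle"
    and nb: "\<And>g. g \<in> U \<Longrightarrow> \<exists>V. id_nbhd \<sigma> V \<and> (\<forall>v\<in>V. g \<circ> v \<in> U)"
  shows "openin \<sigma> U"
proof (subst openin_subopen, safe)
  fix g assume g: "g \<in> U"
  then obtain V where V: "id_nbhd \<sigma> V" "\<And>v. v \<in> V \<Longrightarrow> g \<circ> v \<in> U" using nb by blast
  have gA: "g \<in> Aut_circle" using g U by blast
  let ?T = "{f \<in> topspace \<sigma>. inv_into UNIV g \<circ> f \<in> V}"
  have "continuous_map \<sigma> \<sigma> (\<lambda>f. inv_into UNIV g \<circ> f)"
    by (intro continuous_map_mult continuous_map_const_Aut continuous_map_self gA
        Aut_circle_closed(4))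
  then have "openin \<sigma> ?T"
    using V(1) by (intro openin_continuous_map_preimage) (auto simp: id_nbhd_def)
  moreover have "inv_into UNIV g \<circ> g = id" using Aut_circle_inv(2)[OF gA] by auto
  then have "g \<in> ?T" using V(1) gA by (simp add: topspace id_nbhd_def)
  moreover have "?T \<subseteq> U"
  proof
    fix f assume "f \<in> ?T"
    then have "g \<circ> (inv_into UNIV g \<circ> f) \<in> U" using V(2) by blast
    moreover have "g \<circ> (inv_into UNIV g \<circ> f) = f" using Aut_circle_inv(1)[OF gA] by auto
    ultimately show "f \<in> U" by simp
  qed
  ultimately show "\<exists>T. openin \<sigma> T \<and> g \<in> T \<and> T \<subseteq> U" by blast
qed

lemma id_nbhd_translate:
  assumes U: "openin \<sigma> U" and g: "g \<in> U"
  shows "id_nbhd \<sigma> {v \<in> Aut_circle. g \<circ> v \<in> U}"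
proof -
  have "g \<in> Aut_circle" using openin_subset[OF U] g topspace by blast
  then have "continuous_map \<sigma> \<sigma> (\<lambda>v. g \<circ> v)"
    by (intro continuous_map_mult continuous_map_const_Aut continuous_map_self)
  from openin_continuous_map_preimage[OF this U] show ?thesis
    using g Aut_circle_closed(2) by (simp add: id_nbhd_def topspace)
qed

text \<open>If \<open>f\<close> maps an arc off itself, then the conjugate by \<open>f\<close> of a map supported in the arc
  commutes with every map supported in the arc; and non-commuting is an open condition in every
  Hausdorff group topology.\<close>

lemma id_nbhd_arc_recurrent:
  assumes "p \<noteq> q"
  obtains V where "id_nbhd \<sigma> V"
    "\<And>f. f \<in> V \<Longrightarrow> \<exists>x. circ_ord p x q \<and> circ_ord p (f x) q"
proof -
  obtain s t where s: "s \<in> Aut_circle" "\<And>z. \<not> circ_ord p z q \<Longrightarrow> s z = z"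
    and t: "t \<in> Aut_circle" "\<And>z. \<not> circ_ord p z q \<Longrightarrow> t z = z" and st: "s \<circ> t \<noteq> t \<circ> s"
    using arc_noncommuting[OF assms] by metis
  define C where "C f = f \<circ> s \<circ> inv_into UNIV f" for f :: "rat_circle \<Rightarrow> rat_circle"
  have contC: "continuous_map \<sigma> \<sigma> C"
    unfolding C_def
    by (intro continuous_map_mult continuous_map_const_Aut continuous_map_self
        continuous_map_inv s)
  define V where "V = {f \<in> topspace \<sigma>. C f \<circ> t \<noteq> t \<circ> C f}"
  have "closedin \<sigma> {f \<in> topspace \<sigma>. C f \<circ> t = t \<circ> C f}"
    by (intro closedin_continuous_maps_eq[OF Hausdorff] continuous_map_mult contC
        continuous_map_const_Aut t)
  then have "openin \<sigma> (topspace \<sigma> - {f \<in> topspace \<sigma>. C f \<circ> t = t \<circ> C f})"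
    by (rule openin_diff[OF openin_topspace])
  moreover have "topspace \<sigma> - {f \<in> topspace \<sigma>. C f \<circ> t = t \<circ> C f} = V"
    by (auto simp: V_def)
  moreover have "C id = s" by (simp add: C_def)
  ultimately have "id_nbhd \<sigma> V"
    using st Aut_circle_closed(2) by (simp add: id_nbhd_def V_def topspace)
  moreover have "\<exists>x. circ_ord p x q \<and> circ_ord p (f x) q" if "f \<in> V" for f
  proof (rule ccontr)
    assume "\<not> ?thesis"
    then have off: "\<not> circ_ord p (f x) q" if "circ_ord p x q" for x using that by blast
    have f: "f \<in> Aut_circle" using that by (simp add: V_def topspace)
    have off': "\<not> circ_ord p (inv_into UNIV f x) q" if "circ_ord p x q" for x
      using off[of "inv_into UNIV f x"] that Aut_circle_inv(1)[OF f] by auto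
    \<comment> \<open>On the arc \<open>C f\<close> is the identity, because the inverse of
      \<open>f\<close> leads out of the arc, where \<open>s\<close> acts trivially. Since
      \<open>t\<close> acts trivially off the arc and each map preserves both regions, the two
      commute.\<close>
    have Cs: "C f x = x" if "circ_ord p x q" for x
      using s(2)[OF off'[OF that]] by (simp add: C_def Aut_circle_inv(1)[OF f])
    have sarc: "circ_ord p (s y) q" if "circ_ord p y q" for y
      using s that Aut_circle_inj[OF s(1)] by metis
    have tarc: "circ_ord p (t y) q" if "circ_ord p y q" for y
      using t that Aut_circle_inj[OF t(1)] by metis
    have Cout: "\<not> circ_ord p (C f x) q" if x: "\<not> circ_ord p x q" for x
    proof (cases "circ_ord p (inv_into UNIV f x) q")
      case True
      then show ?thesis using off sarc by (simp add: C_def)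
    next
      case False
      then show ?thesis using x by (simp add: C_def s(2) Aut_circle_inv(1)[OF f])
    qed
    have "C f (t x) = t (C f x)" for x
    proof (cases "circ_ord p x q")
      case True
      then show ?thesis using Cs tarc by simp
    next
      case False
      then show ?thesis using t(2) Cout by simp
    qed
    then have "C f \<circ> t = t \<circ> C f" by auto
    then show False using that by (simp add: V_def)
  qed
  ultimately show thesis by (rule that)
qed

text \<open>Recurrence is applied to the two arcs on either side of \<open>a\<close>: the recurrent
  points \<open>x\<close> and \<open>y\<close>, which may depend on \<open>f\<close>, enclose
  \<open>a\<close>, so \<open>f x\<close> and \<open>f y\<close> enclose \<open>f a\<close>.\<close>

lemma id_nbhd_into_arc:
  assumes a: "circ_ord p a q"
  obtains V where "id_nbhd \<sigma> V" "\<And>f. f \<in> V \<Longrightarrow> circ_ord p (f a) q"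
proof -
  have "p \<noteq> a" "a \<noteq> q" using circ_ord_distinct[OF a] by auto
  obtain V where V: "id_nbhd \<sigma> V" "\<And>f. f \<in> V \<Longrightarrow> \<exists>x. circ_ord p x a \<and> circ_ord p (f x) a"
    using id_nbhd_arc_recurrent[OF \<open>p \<noteq> a\<close>] by metis
  obtain W where W: "id_nbhd \<sigma> W" "\<And>f. f \<in> W \<Longrightarrow> \<exists>x. circ_ord a x q \<and> circ_ord a (f x) q"
    using id_nbhd_arc_recurrent[OF \<open>a \<noteq> q\<close>] by metis
  show thesis
  proof (rule that[OF id_nbhd_Int[OF V(1) W(1)]])
    fix f assume f: "f \<in> V \<inter> W"
    then have fA: "f \<in> Aut_circle" using id_nbhd_subset[OF V(1)] by blast
    obtain x y where x: "circ_ord p x a" "circ_ord p (f x) a"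
      and y: "circ_ord a y q" "circ_ord a (f y) q"
      using f V(2) W(2) by blast
    have "circ_ord x a y" using x(1) circ_ord_trans_left[OF a y(1)] by (rule circ_ord_chain)
    then have "circ_ord (f x) (f a) (f y)" by (simp add: Aut_circleD(2)[OF fA])
    then show "circ_ord p (f a) q" by (rule circ_ord_arc_subset[OF a x(2) y(2)])
  qed
qed

text \<open>If some \<open>v b\<close> were outside the finite set \<open>F\<close>, a map
  \<open>g\<close> fixing \<open>F\<close> and \<open>v a\<close> but moving \<open>v b\<close>
  would be in \<open>V\<close>. Its conjugate by the inverse of \<open>v\<close> would lie in
  \<open>U\<close>, fix \<open>a\<close> and move \<open>b\<close>.\<close>

lemma id_nbhd_stabilizer:
  assumes "a \<noteq> b" and U: "id_nbhd \<sigma> U" and sub: "U \<inter> stabilizer_circle a \<subseteq> stabilizer_circle b"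
  obtains V where "id_nbhd \<sigma> V" "V \<subseteq> stabilizer_circle b"
proof -
  obtain V where V: "id_nbhd \<sigma> V" "\<And>f. f \<in> V \<Longrightarrow> inv_into UNIV f \<in> V"
    "\<And>f g h. f \<in> V \<Longrightarrow> g \<in> V \<Longrightarrow> h \<in> V \<Longrightarrow> f \<circ> g \<circ> h \<in> U"
    using id_nbhd_mult3[OF U] by metis
  obtain F where F: "finite F" "\<And>g. g \<in> Aut_circle \<Longrightarrow> (\<And>x. x \<in> F \<Longrightarrow> g x = x) \<Longrightarrow> g \<in> V"
    using id_nbhd_finite_support[OF V(1)] by metis
  have orbit: "v b \<in> F" if v: "v \<in> V" for v
  proof (rule ccontr)
    assume nF: "v b \<notin> F"
    have vA: "v \<in> Aut_circle" using v id_nbhd_subset[OF V(1)] by blast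
    then have ne: "v a \<noteq> v b" using assms(1) by (simp add: Aut_circle_inj)
    obtain p q where pq: "circ_ord p (v b) q"
      "\<And>z. circ_ord p z q \<Longrightarrow> z \<in> insert (v a) F \<Longrightarrow> z = v b"
      using arc_around_avoiding[of "insert (v a) F" "v b"] F(1) by blast
    obtain y where y: "circ_ord p y (v b)"
      using circ_ord_dense circ_ord_distinct[OF pq(1)] by metis
    have "circ_ord p y q" using y pq(1) by (rule circ_ord_trans)
    then obtain g where g: "g \<in> Aut_circle" "g (v b) = y" "\<And>z. \<not> circ_ord p z q \<Longrightarrow> g z = z"
      using arc_homogeneous[OF pq(1)] by blast
    have fix_va: "g (v a) = v a" using g(3) pq(2)[of "v a"] ne by blast
    have "g x = x" if "x \<in> F" for x using g(3) pq(2)[of x] that nF by blast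
    then have "g \<in> V" using F(2) g(1) by blast
    then have u: "inv_into UNIV v \<circ> g \<circ> v \<in> U" using V(2,3) v by blast
    have "inv_into UNIV v \<circ> g \<circ> v \<in> stabilizer_circle a"
      using u id_nbhd_subset[OF U] fix_va Aut_circle_inv(2)[OF vA]
      by (auto simp: stabilizer_circle_def)
    then have "inv_into UNIV v \<circ> g \<circ> v \<in> stabilizer_circle b" using u sub by blast
    then have "inv_into UNIV v (g (v b)) = b" by (simp add: stabilizer_circle_def)
    then have "y = v b" using g(2) Aut_circle_inv(1)[OF vA] by metis
    then show False using circ_ord_distinct[OF y] by blast
  qed
  \<comment> \<open>The images of \<open>b\<close> under \<open>V\<close> lie in the finite set
    \<open>F\<close>, so keeping them in an arc that meets \<open>F\<close> at most in
    \<open>b\<close> forces \<open>b\<close> to be fixed.\<close>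
  obtain p q where pq: "circ_ord p b q" "\<And>z. circ_ord p z q \<Longrightarrow> z \<in> F \<Longrightarrow> z = b"
    using arc_around_avoiding[OF F(1)] by blast
  obtain W where W: "id_nbhd \<sigma> W" "\<And>f. f \<in> W \<Longrightarrow> circ_ord p (f b) q"
    using id_nbhd_into_arc[OF pq(1)] by metis
  have "V \<inter> W \<subseteq> stabilizer_circle b"
    using orbit pq(2) W(2) id_nbhd_subset[OF V(1)] by (auto simp: stabilizer_circle_def)
  then show thesis using that id_nbhd_Int[OF V(1) W(1)] by blast
qed

text \<open>By transitivity, conjugates of \<open>V\<close> give a neighbourhood fixing any given
  point, and finite intersections give neighbourhoods inside every basic pointwise one.\<close>

lemma openin_if_id_nbhd_stabilizer:
  assumes V: "id_nbhd \<sigma> V" "V \<subseteq> stabilizer_circle b"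
    and U: "openin (pointwise_topology Aut_circle) U"
  shows "openin \<sigma> U"
proof (rule openinI)
  show UA: "U \<subseteq> Aut_circle" using U openin_subset by fastforce
  have stab: "\<exists>W. id_nbhd \<sigma> W \<and> (\<forall>w\<in>W. w x = x)" for x
  proof -
    obtain g where g: "g \<in> Aut_circle" "g b = x" by (rule Aut_circle_transitive)
    have "w x = x" if "w \<in> Aut_circle" "inv_into UNIV g \<circ> w \<circ> g \<in> V" for w
    proof -
      have "inv_into UNIV g (w (g b)) = b" using that V(2) by (auto simp: stabilizer_circle_def)
      then show ?thesis using g Aut_circle_inv(1)[OF g(1)] by metis
    qed
    then show ?thesis using id_nbhd_conj[OF V(1) g(1)] by blast
  qed
  have fin: "\<exists>W. id_nbhd \<sigma> W \<and> (\<forall>w\<in>W. \<forall>x\<in>F. w x = x)" if "finite F" for F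
    using that
  proof induction
    case empty
    then show ?case using V(1) by blast
  next
    case (insert x F)
    then obtain W where "id_nbhd \<sigma> W" "\<forall>w\<in>W. \<forall>x\<in>F. w x = x" by blast
    moreover obtain W' where "id_nbhd \<sigma> W'" "\<forall>w\<in>W'. w x = x" using stab by blast
    ultimately show ?case by (intro exI[of _ "W \<inter> W'"]) (simp add: id_nbhd_Int)
  qed
  fix g assume g: "g \<in> U"
  then obtain F where F: "finite F" "\<And>h. h \<in> Aut_circle \<Longrightarrow> (\<forall>x\<in>F. h x = g x) \<Longrightarrow> h \<in> U"
    using U unfolding openin_pointwise_topology by metis
  obtain W where W: "id_nbhd \<sigma> W" "\<forall>w\<in>W. \<forall>x\<in>F. w x = x" using fin[OF F(1)] by blast
  have "g \<circ> w \<in> U" if w: "w \<in> W" for w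
  proof (rule F(2))
    show "g \<circ> w \<in> Aut_circle"
      using Aut_circle_closed(3) g UA w id_nbhd_subset[OF W(1)] by blast
    show "\<forall>x\<in>F. (g \<circ> w) x = g x" using bspec[OF W(2) w] by simp
  qed
  then show "\<exists>W. id_nbhd \<sigma> W \<and> (\<forall>w\<in>W. g \<circ> w \<in> U)" using W(1) by blast
qed

end

section \<open>Two topologies with the same trace on a stabilizer\<close>

lemma id_nbhd_transfer:
  assumes eq: "subtopology \<sigma>\<^sub>1 H = subtopology \<sigma>\<^sub>2 H" and V: "id_nbhd \<sigma>\<^sub>2 V" and "id \<in> H"
  obtains W where "id_nbhd \<sigma>\<^sub>1 W" "W \<inter> H = V \<inter> H"
proof -
  have "openin (subtopology \<sigma>\<^sub>2 H) (V \<inter> H)"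
    using V by (auto simp: id_nbhd_def openin_subtopology)
  then obtain W where W: "openin \<sigma>\<^sub>1 W" "V \<inter> H = W \<inter> H"
    unfolding eq[symmetric] openin_subtopology by blast
  moreover have "id \<in> W" using W(2) V \<open>id \<in> H\<close> by (auto simp: id_nbhd_def)
  ultimately show thesis using that by (simp add: id_nbhd_def)
qed

lemma coarser_circle_topology_mono:
  assumes "coarser_circle_topology \<sigma>\<^sub>1" "coarser_circle_topology \<sigma>\<^sub>2"
    and eq: "subtopology \<sigma>\<^sub>1 (stabilizer_circle a) = subtopology \<sigma>\<^sub>2 (stabilizer_circle a)"
    and U: "openin \<sigma>\<^sub>2 U"
  shows "openin \<sigma>\<^sub>1 U"
proof -
  interpret s1: coarser_circle_topology \<sigma>\<^sub>1 by fact
  interpret s2: coarser_circle_topology \<sigma>\<^sub>2 by fact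
  let ?H = "stabilizer_circle a"
  have idH: "id \<in> ?H" using Aut_circle_closed(2) by (simp add: stabilizer_circle_def)
  show ?thesis
  proof (cases "\<exists>W V. id_nbhd \<sigma>\<^sub>1 W \<and> id_nbhd \<sigma>\<^sub>2 V \<and> W \<inter> V \<subseteq> ?H")
    case True
    then obtain W V where W: "id_nbhd \<sigma>\<^sub>1 W" and V: "id_nbhd \<sigma>\<^sub>2 V" and WV: "W \<inter> V \<subseteq> ?H"
      by blast
    \<comment> \<open>Conjugation by \<open>g\<close> moves the inclusion to the stabilizer of
      \<open>b\<close>. The set \<open>?V\<close> can then be replaced on \<open>?H\<close> by a
      neighbourhood \<open>T\<close> from \<open>\<sigma>\<^sub>1\<close>, leaving a condition on
      \<open>\<sigma>\<^sub>1\<close> alone.\<close>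
    obtain b where ab: "a \<noteq> b" using chart_neq by metis
    obtain g where g: "g \<in> Aut_circle" "g a = b" by (rule Aut_circle_transitive)
    let ?W = "{f \<in> Aut_circle. inv_into UNIV g \<circ> f \<circ> g \<in> W}"
    let ?V = "{f \<in> Aut_circle. inv_into UNIV g \<circ> f \<circ> g \<in> V}"
    have WV': "?W \<inter> ?V \<subseteq> stabilizer_circle b"
    proof
      fix f assume f: "f \<in> ?W \<inter> ?V"
      then have "inv_into UNIV g \<circ> f \<circ> g \<in> ?H" using WV by blast
      then have "inv_into UNIV g (f (g a)) = a" by (simp add: stabilizer_circle_def)
      then have "f b = b" using g Aut_circle_inv(1)[OF g(1)] by metis
      then show "f \<in> stabilizer_circle b" using f by (simp add: stabilizer_circle_def)
    qed
    obtain T where T: "id_nbhd \<sigma>\<^sub>1 T" "T \<inter> ?H = ?V \<inter> ?H"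
      by (rule id_nbhd_transfer[OF eq s2.id_nbhd_conj[OF V g(1)] idH])
    have "(?W \<inter> T) \<inter> ?H \<subseteq> stabilizer_circle b" using T(2) WV' by blast
    then obtain Y where "id_nbhd \<sigma>\<^sub>1 Y" "Y \<subseteq> stabilizer_circle b"
      using s1.id_nbhd_stabilizer[OF ab id_nbhd_Int[OF s1.id_nbhd_conj[OF W g(1)] T(1)]] by metis
    then show ?thesis
      using s2.openin_pointwise[OF U] by (rule s1.openin_if_id_nbhd_stabilizer)
  next
    case False
    have "\<exists>W. id_nbhd \<sigma>\<^sub>1 W \<and> W \<subseteq> U" if U: "id_nbhd \<sigma>\<^sub>2 U" for U
    proof -
      obtain V where V: "id_nbhd \<sigma>\<^sub>2 V" "\<And>f. f \<in> V \<Longrightarrow> inv_into UNIV f \<in> V"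
        "\<And>f g h. f \<in> V \<Longrightarrow> g \<in> V \<Longrightarrow> h \<in> V \<Longrightarrow> f \<circ> g \<circ> h \<in> U"
        using s2.id_nbhd_mult3[OF U] by metis
      obtain W where W: "id_nbhd \<sigma>\<^sub>1 W" "W \<inter> ?H = V \<inter> ?H"
        using id_nbhd_transfer[OF eq V(1) idH] by metis
      obtain X where X: "id_nbhd \<sigma>\<^sub>1 X" "\<And>f. f \<in> X \<Longrightarrow> inv_into UNIV f \<in> X"
        "\<And>f g h. f \<in> X \<Longrightarrow> g \<in> X \<Longrightarrow> h \<in> X \<Longrightarrow> f \<circ> g \<circ> h \<in> W"
        using s1.id_nbhd_mult3[OF W(1)] by metis
      have idX: "id \<in> X" using X(1) by (simp add: id_nbhd_def)
      obtain F\<^sub>1 where F1: "finite F\<^sub>1"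
        "\<And>g. g \<in> Aut_circle \<Longrightarrow> (\<And>x. x \<in> F\<^sub>1 \<Longrightarrow> g x = x) \<Longrightarrow> g \<in> X"
        using s1.id_nbhd_finite_support[OF X(1)] by metis
      obtain F\<^sub>2 where F2: "finite F\<^sub>2"
        "\<And>g. g \<in> Aut_circle \<Longrightarrow> (\<And>x. x \<in> F\<^sub>2 \<Longrightarrow> g x = x) \<Longrightarrow> g \<in> V"
        using s2.id_nbhd_finite_support[OF V(1)] by metis
      obtain p q where pq: "circ_ord p a q" "\<And>z. circ_ord p z q \<Longrightarrow> z \<in> F\<^sub>1 \<union> F\<^sub>2 \<Longrightarrow> z = a"
        using arc_around_avoiding[of "F\<^sub>1 \<union> F\<^sub>2" a] F1(1) F2(1) by blast
      \<comment> \<open>\<open>c\<close> is a marker outside the arc around \<open>a\<close>;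
        keeping its image outside as well makes \<open>v\<close> and its inverse move
        \<open>a\<close> to opposite sides.\<close>
      obtain c where c: "circ_ord q c p" using circ_ord_dense circ_ord_distinct[OF pq(1)] by metis
      obtain A where A: "id_nbhd \<sigma>\<^sub>1 A" "\<And>f. f \<in> A \<Longrightarrow> circ_ord p (f a) q"
        using s1.id_nbhd_into_arc[OF pq(1)] by metis
      obtain C where C: "id_nbhd \<sigma>\<^sub>1 C" "\<And>f. f \<in> C \<Longrightarrow> circ_ord q (f c) p"
        using s1.id_nbhd_into_arc[OF c] by metis
      obtain Y where Y: "id_nbhd \<sigma>\<^sub>1 Y" "\<And>f. f \<in> Y \<Longrightarrow> inv_into UNIV f \<in> Y"
        "\<And>f g h. f \<in> Y \<Longrightarrow> g \<in> Y \<Longrightarrow> h \<in> Y \<Longrightarrow> f \<circ> g \<circ> h \<in> X \<inter> A \<inter> C"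
        using s1.id_nbhd_mult3[OF id_nbhd_Int[OF id_nbhd_Int[OF X(1) A(1)] C(1)]] by metis
      have Ysub: "f \<in> X" "f \<in> A" "f \<in> C" "f \<in> Aut_circle" if "f \<in> Y" for f
        using Y(3)[OF that, of id id] Y(1) that s1.id_nbhd_subset[OF Y(1)] by (auto simp: id_nbhd_def)
      obtain v where v: "v \<in> Y" "v \<in> V" "v \<notin> ?H" using False Y(1) V(1) by blast
      let ?v' = "inv_into UNIV v"
      have v': "?v' \<in> Y" "?v' \<in> V" using v Y(2) V(2) by blast+
      have vA: "v \<in> Aut_circle" using v(1) Ysub by blast
      have "v a \<noteq> a" using v(3) vA by (simp add: stabilizer_circle_def)
      then have side: "circ_ord p (v a) a \<or> circ_ord a (v a) q"
        using circ_ord_arc_split[OF A(2) pq(1)] Ysub(2)[OF v(1)] by blast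
      note opp = inv_moves_opposite[OF vA pq(1) A(2)[OF Ysub(2)[OF v'(1)]] c
          C(2)[OF Ysub(3)[OF v(1)]]]
      have right: "\<exists>u \<in> Y \<inter> V. circ_ord a (u a) q" using side opp(2) v v' by blast
      have left: "\<exists>u \<in> Y \<inter> V. circ_ord p (u a) a" using side opp(1) v v' by blast
      \<comment> \<open>An element \<open>u\<close> of \<open>Y \<inter> V\<close> carries
        \<open>a\<close> to the side of \<open>w a\<close>, and \<open>g\<close>, supported on that
        side, finishes the move. That side contains no point of \<open>F\<^sub>1\<close> or
        \<open>F\<^sub>2\<close>, so \<open>g\<close> lies in both neighbourhoods.\<close>
      have reach: "\<exists>u\<in>X \<inter> V. \<exists>g\<in>X \<inter> V. g (u a) = w a" if w: "w \<in> Y" for w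
      proof -
        have wa: "circ_ord p (w a) q" using A(2) Ysub(2)[OF w] by blast
        consider "w a = a" | "circ_ord p (w a) a" | "circ_ord a (w a) q"
          using circ_ord_arc_split[OF wa pq(1)] by blast
        then show ?thesis
        proof cases
          case 1
          then show ?thesis using idX V(1) by (intro bexI[of _ id]) (auto simp: id_nbhd_def)
        next
          case 2
          obtain u where u: "u \<in> Y \<inter> V" "circ_ord p (u a) a" using left by blast
          obtain g where g: "g \<in> Aut_circle" "g (u a) = w a"
            "\<And>z. \<not> circ_ord p z a \<Longrightarrow> g z = z"
            using arc_homogeneous[OF u(2) 2] by blast
          have "g z = z" if "z \<in> F\<^sub>1 \<union> F\<^sub>2" for z
            using g(3) pq(2)[OF circ_ord_trans[OF _ pq(1)] that] circ_ord_distinct by metis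
          then have "g \<in> X \<inter> V" using F1(2) F2(2) g(1) by blast
          then show ?thesis using u(1) g(2) Ysub(1) by blast
        next
          case 3
          obtain u where u: "u \<in> Y \<inter> V" "circ_ord a (u a) q" using right by blast
          obtain g where g: "g \<in> Aut_circle" "g (u a) = w a"
            "\<And>z. \<not> circ_ord a z q \<Longrightarrow> g z = z"
            using arc_homogeneous[OF u(2) 3] by blast
          have "g z = z" if "z \<in> F\<^sub>1 \<union> F\<^sub>2" for z
            using g(3) pq(2)[OF circ_ord_trans_right[OF pq(1)] that] circ_ord_distinct by metis
          then have "g \<in> X \<inter> V" using F1(2) F2(2) g(1) by blast
          then show ?thesis using u(1) g(2) Ysub(1) by blast
        qed
      qed
      have "w \<in> U" if w: "w \<in> Y" for w
      proof -
        obtain u g where u: "u \<in> X" "u \<in> V" and g: "g \<in> X" "g \<in> V" and gu: "g (u a) = w a"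
          using reach[OF w] by blast
        have uA: "u \<in> Aut_circle" and gA: "g \<in> Aut_circle"
          using u(1) g(1) s1.id_nbhd_subset[OF X(1)] by blast+
        \<comment> \<open>The factor \<open>h\<close> fixes \<open>a\<close> and lies in
          \<open>W\<close>, hence in \<open>V\<close> because the traces on \<open>?H\<close> agree;
          then \<open>w = g \<circ> u \<circ> h\<close> is a product of three elements of
          \<open>V\<close>.\<close>
        define h where "h = inv_into UNIV u \<circ> inv_into UNIV g \<circ> w"
        have hW: "h \<in> W" unfolding h_def using X(2,3) u(1) g(1) Ysub(1)[OF w] by blast
        have "h a = a"
          by (simp add: h_def Aut_circle_inv(2)[OF gA] Aut_circle_inv(2)[OF uA] flip: gu)
        then have "h \<in> ?H"
          using hW s1.id_nbhd_subset[OF W(1)] by (auto simp: stabilizer_circle_def)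
        then have "h \<in> V" using hW W(2) by blast
        then have "g \<circ> u \<circ> h \<in> U" using V(3) u(2) g(2) by blast
        moreover have "g \<circ> u \<circ> h = w"
          by (simp add: fun_eq_iff h_def Aut_circle_inv(1)[OF gA] Aut_circle_inv(1)[OF uA])
        ultimately show ?thesis by simp
      qed
      then show ?thesis using Y(1) by blast
    qed
    note finer = this
    show ?thesis
    proof (rule s1.openinI)
      show "U \<subseteq> Aut_circle" using openin_subset[OF U] by (simp add: s2.topspace)
      fix g assume "g \<in> U"
      then show "\<exists>V. id_nbhd \<sigma>\<^sub>1 V \<and> (\<forall>v\<in>V. g \<circ> v \<in> U)"
        using finer[OF s2.id_nbhd_translate[OF U]] by blast
    qed
  qed
qed

lemma inj_key_stabilizer_circle:
  "inj_key (permutation_group Aut_circle) (pointwise_topology Aut_circle) (stabilizer_circle a)"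
  unfolding inj_key_def
proof (intro ballI impI)
  let ?T = "coarser_hausdorff_topologies (permutation_group Aut_circle) (pointwise_topology Aut_circle)"
  fix \<sigma>\<^sub>1 \<sigma>\<^sub>2
  assume "\<sigma>\<^sub>1 \<in> ?T" "\<sigma>\<^sub>2 \<in> ?T"
    and eq: "subtopology \<sigma>\<^sub>1 (stabilizer_circle a) = subtopology \<sigma>\<^sub>2 (stabilizer_circle a)"
  then have "coarser_circle_topology \<sigma>\<^sub>1" "coarser_circle_topology \<sigma>\<^sub>2"
    by (simp_all add: coarser_circle_topology_def)
  then show "\<sigma>\<^sub>1 = \<sigma>\<^sub>2"
    unfolding topology_eq using eq coarser_circle_topology_mono by metis
qed

theorem theorem3p1:
  fixes a\<^sub>0 :: rat_circle
  defines "G \<equiv> permutation_group Aut_circle"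
    and "\<tau>\<^sub>0 \<equiv> pointwise_topology Aut_circle"
    and "H \<equiv> stabilizer_circle a\<^sub>0"
  shows "topologically_isomorphic (G\<lparr>carrier := H\<rparr>) (subtopology \<tau>\<^sub>0 H)
           (permutation_group Aut_rat) (pointwise_topology Aut_rat) \<and>
         inj_key G \<tau>\<^sub>0 H \<and>
         \<not> co_minimal G \<tau>\<^sub>0 H"
  unfolding G_def \<tau>\<^sub>0_def H_def
  using topologically_isomorphic_stabilizer_circle inj_key_stabilizer_circle
    not_co_minimal_stabilizer_circle by blast

end
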